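(* Let $\alpha\in[0,1]$ and let $U\subset\mathbb{R}^d$ be a bounded open set such that $\partial U$ is $(d-1+\alpha)$-summable. Then the $d$-current $\llbracket U\rrbracket$ is $\alpha$-fractional.
   Context: A dyadic $k$-cube ($k\in\mathbb{Z}$) is a set $\prod_{i=1}^d[\ell_i2^{-k},(\ell_i+1)2^{-k}]$ with $\ell_1,\dots,\ell_d\in\mathbb{Z}$. For a bounded set $A\subset\mathbb{R}^d$, $N_A(k)$ is the number of dyadic $k$-cubes that intersect $A$. For real $s\ge0$, $A$ is $s$-summable if $\sum_{k=0}^\infty N_A(k)2^{-ks}<\infty$. $\llbracket U\rrbracket$ is the $d$-current $g\,dx_1\wedge\dots\wedge dx_d\mapsto\int_Ug\,dx$. Currents: a (compactly supported) $m$-current $T$ in $\mathbb{R}^d$ is a continuous linear functional on $C^\infty(\mathbb{R}^d;\wedge^m\mathbb{R}^d)$ (smooth $m$-forms with the usual topology); $\partial T(\omega)=T(d\omega)$ for $m\ge1$. Covectors carry the comass norm and $\|\omega\|_\infty$ is the supremum of the comass. $\mathbf M(T)=\sup\{T(\omega):\|\omega\|_\infty\le1\}$; $\mathbf N(T)=\mathbf M(T)+\mathbf M(\partial T)$ for $m\ge1$, $\mathbf N=\mathbf M$ for $m=0$; $T$ is normal if $\mathbf N(T)<\infty$. For normal $T$, the flat norm is $\mathbf F(T)=\sup\{T(\omega):\max\{\|\omega\|_\infty,\|d\omega\|_\infty\}\le1\}$. $T$ is flat if it is the weak limit of an $\mathbf F$-Cauchy sequence $(T_n)$ of normal currents with $\bigcup_n\operatorname{spt}T_n$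 relatively compact; then $\mathbf F(T)=\lim\mathbf F(T_n)$. A flat $m$-current $T$ is $\alpha$-fractional if there is a sequence $(T_k)_{k\ge0}$ of normal $m$-currents, all supported in a common compact set, with $\sum_k\mathbf N(T_k)^{1-\alpha}\mathbf F(T_k)^\alpha<\infty$ and $T=\sum_kT_k$ ($\mathbf F$-convergent series). *)

theory Defs
  imports "HOL-Analysis.Analysis"
begin

section \<open>Smooth differential forms\<close>

text \<open>
  An \<open>m\<close>-covector is an alternating \<open>m\<close>-linear function of lists of \<open>m\<close> vectors, extended by \<open>0\<close> to
  lists of any other length, so that covectors are equal exactly when they agree on \<open>m\<close>-tuples.
\<close>

definition covectors :: "nat \<Rightarrow> ('a::euclidean_space list \<Rightarrow> real) set" where
  "covectors m = {\<phi>.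
     (\<forall>vs. length vs \<noteq> m \<longrightarrow> \<phi> vs = 0) \<and>
     (\<forall>vs i. length vs = m \<and> i < m \<longrightarrow> linear (\<lambda>v. \<phi> (vs[i := v]))) \<and>
     (\<forall>vs i j. length vs = m \<and> i < j \<and> j < m \<and> vs ! i = vs ! j \<longrightarrow> \<phi> vs = 0)}"

fun iter_deriv :: "'a::euclidean_space list \<Rightarrow> ('a \<Rightarrow> real) \<Rightarrow> 'a \<Rightarrow> real" where
  "iter_deriv [] f = f"
| "iter_deriv (w # ws) f = (\<lambda>x. frechet_derivative (iter_deriv ws f) (at x) w)"

definition smooth :: "('a::euclidean_space \<Rightarrow> real) \<Rightarrow> bool" where
  "smooth f \<longleftrightarrow> (\<forall>ws x. iter_deriv ws f differentiable (at x))"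

type_synonym 'a form = "'a \<Rightarrow> 'a list \<Rightarrow> real"

definition smooth_forms :: "nat \<Rightarrow> 'a::euclidean_space form set" where
  "smooth_forms m = {\<omega>. (\<forall>x. \<omega> x \<in> covectors m) \<and> (\<forall>vs. smooth (\<lambda>x. \<omega> x vs))}"

text \<open>
  The exterior derivative
  \<open>d\<omega>\<^sub>x(v\<^sub>0,\<dots>,v\<^sub>m) = \<Sum>\<^sub>i (-1)\<^sup>i D(\<omega>(\<cdot>)(v\<^sub>0,\<dots>,v\<^sub>i\<^sub>-\<^sub>1,v\<^sub>i\<^sub>+\<^sub>1,\<dots>,v\<^sub>m))(x) v\<^sub>i\<close>, in the determinant convention,
  in which \<open>(dx\<^sub>1 \<and> \<dots> \<and> dx\<^sub>m)(v\<^sub>1,\<dots>,v\<^sub>m) = det (dx\<^sub>i(v\<^sub>j))\<close>.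
\<close>

definition ext_deriv :: "'a::euclidean_space form \<Rightarrow> 'a form" where
  "ext_deriv \<omega> = (\<lambda>x vs. \<Sum>i<length vs.
     (- 1) ^ i * frechet_derivative (\<lambda>y. \<omega> y (take i vs @ drop (Suc i) vs)) (at x) (vs ! i))"

text \<open>
  The topology of uniform convergence on compact sets of all partial derivatives of all
  components.  The sets below are the balls of the defining seminorms
  \<open>max {\<bar>\<partial>\<^sub>w\<^sub>s \<omega>\<^sub>v\<^sub>s(x)\<bar> : x \<in> K, length ws \<le> k}\<close>.
\<close>

definition form_ball ::
    "nat \<Rightarrow> 'a::euclidean_space set \<Rightarrow> nat \<Rightarrow> real \<Rightarrow> 'a form \<Rightarrow> 'a form set" where
  "form_ball m K k \<epsilon> \<omega> = {\<eta> \<in> smooth_forms m. \<forall>x\<in>K. \<forall>vs ws.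
     set vs \<subseteq> Basis \<and> length vs = m \<and> set ws \<subseteq> Basis \<and> length ws \<le> k \<longrightarrow>
       \<bar>iter_deriv ws (\<lambda>y. \<eta> y vs - \<omega> y vs) x\<bar> < \<epsilon>}"

definition form_topology :: "nat \<Rightarrow> 'a::euclidean_space form topology" where
  "form_topology m = topology_generated_by
     {form_ball m K k \<epsilon> \<omega> | K k \<epsilon> \<omega>. compact K \<and> 0 < \<epsilon> \<and> \<omega> \<in> smooth_forms m}"

text \<open>
  The Euclidean norm of the simple \<open>m\<close>-vector \<open>v\<^sub>1 \<and> \<dots> \<and> v\<^sub>m\<close> is the square root of the Gram
  determinant, and the comass is the supremum over simple \<open>m\<close>-vectors of norm at most \<open>1\<close>.
  The absolute value matters only for \<open>m = 0\<close>, where the empty list represents the simple \<open>0\<close>-vector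
  \<open>1\<close> but not \<open>-1\<close>.
\<close>

definition simple_norm :: "'a::euclidean_space list \<Rightarrow> real" where
  "simple_norm vs = sqrt (\<Sum>p | p permutes {..<length vs}.
     of_int (sign p) * (\<Prod>i<length vs. vs ! i \<bullet> vs ! p i))"

definition comass :: "nat \<Rightarrow> ('a::euclidean_space list \<Rightarrow> real) \<Rightarrow> ereal" where
  "comass m \<phi> = (SUP vs \<in> {vs. length vs = m \<and> simple_norm vs \<le> 1}. ereal \<bar>\<phi> vs\<bar>)"

definition comass_sup :: "nat \<Rightarrow> 'a::euclidean_space form \<Rightarrow> ereal" where
  "comass_sup m \<omega> = (SUP x. comass m (\<omega> x))"

section \<open>Currents\<close>

text \<open>
  Functionals are total functions on the type of forms; only their values on \<^term>\<open>smooth_forms m\<close>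
  are meaningful, and only these enter the definitions.
\<close>

type_synonym 'a functional = "'a form \<Rightarrow> real"

definition current :: "nat \<Rightarrow> 'a::euclidean_space functional \<Rightarrow> bool" where
  "current m T \<longleftrightarrow>
     (\<forall>\<omega>\<in>smooth_forms m. \<forall>\<eta>\<in>smooth_forms m. T (\<lambda>x vs. \<omega> x vs + \<eta> x vs) = T \<omega> + T \<eta>) \<and>
     (\<forall>\<omega>\<in>smooth_forms m. \<forall>c. T (\<lambda>x vs. c * \<omega> x vs) = c * T \<omega>) \<and>
     continuous_map (form_topology m) euclideanreal T"

definition boundary :: "'a::euclidean_space functional \<Rightarrow> 'a functional" where
  "boundary T = (\<lambda>\<omega>. T (ext_deriv \<omega>))"

definition form_support :: "'a::euclidean_space form \<Rightarrow> 'a set" where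
  "form_support \<omega> = closure {x. \<exists>vs. \<omega> x vs \<noteq> 0}"

definition spt :: "nat \<Rightarrow> 'a::euclidean_space functional \<Rightarrow> 'a set" where
  "spt m T = - \<Union> {W. open W \<and>
     (\<forall>\<omega>\<in>smooth_forms m. compact (form_support \<omega>) \<and> form_support \<omega> \<subseteq> W \<longrightarrow> T \<omega> = 0)}"

definition mass :: "nat \<Rightarrow> 'a::euclidean_space functional \<Rightarrow> ereal" where
  "mass m T = (SUP \<omega> \<in> {\<omega> \<in> smooth_forms m. comass_sup m \<omega> \<le> 1}. ereal (T \<omega>))"

definition normal_mass :: "nat \<Rightarrow> 'a::euclidean_space functional \<Rightarrow> ereal" where
  "normal_mass m T = (if m = 0 then mass 0 T else mass m T + mass (m - 1) (boundary T))"

definition normal_current :: "nat \<Rightarrow> 'a::euclidean_space functional \<Rightarrow> bool" where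
  "normal_current m T \<longleftrightarrow> current m T \<and> normal_mass m T < \<infinity>"

text \<open>
  The flat norm is first given by duality for normal currents, and then extended to flat currents
  by \<open>\<^bold>F(T) = lim \<^bold>F(T\<^sub>n)\<close> along any approximating sequence of normal currents.
\<close>

definition normal_flat_norm :: "nat \<Rightarrow> 'a::euclidean_space functional \<Rightarrow> ereal" where
  "normal_flat_norm m T =
     (SUP \<omega> \<in> {\<omega> \<in> smooth_forms m. max (comass_sup m \<omega>) (comass_sup (Suc m) (ext_deriv \<omega>)) \<le> 1}.
        ereal (T \<omega>))"

definition flat_approx ::
    "nat \<Rightarrow> (nat \<Rightarrow> 'a::euclidean_space functional) \<Rightarrow> 'a functional \<Rightarrow> bool" where
  "flat_approx m S T \<longleftrightarrow>
     (\<forall>n. normal_current m (S n)) \<and>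
     (\<forall>\<epsilon>>0. \<exists>N. \<forall>i\<ge>N. \<forall>j\<ge>N. normal_flat_norm m (\<lambda>\<omega>. S i \<omega> - S j \<omega>) < ereal \<epsilon>) \<and>
     compact (closure (\<Union>n. spt m (S n))) \<and>
     (\<forall>\<omega>\<in>smooth_forms m. (\<lambda>n. S n \<omega>) \<longlonglongrightarrow> T \<omega>)"

definition flat_current :: "nat \<Rightarrow> 'a::euclidean_space functional \<Rightarrow> bool" where
  "flat_current m T \<longleftrightarrow> current m T \<and> (\<exists>S. flat_approx m S T)"

definition flat_norm :: "nat \<Rightarrow> 'a::euclidean_space functional \<Rightarrow> ereal" where
  "flat_norm m T = (THE L. \<exists>S. flat_approx m S T \<and> (\<lambda>n. normal_flat_norm m (S n)) \<longlonglongrightarrow> L)"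

text \<open>
  Here \<^term>\<open>normal_mass m (S k)\<close> and \<^term>\<open>normal_flat_norm m (S k)\<close> are finite because \<open>S k\<close> is
  normal, and they vanish only together (when \<open>S k\<close> is zero); hence the convention \<open>0 powr 0 = 0\<close>
  gives the same products as \<open>0\<^sup>0 = 1\<close> in the cases \<open>\<alpha> = 0\<close> and \<open>\<alpha> = 1\<close>.
\<close>

definition fractional :: "real \<Rightarrow> nat \<Rightarrow> 'a::euclidean_space functional \<Rightarrow> bool" where
  "fractional \<alpha> m T \<longleftrightarrow> flat_current m T \<and>
     (\<exists>S :: nat \<Rightarrow> 'a functional.
        (\<forall>k. normal_current m (S k)) \<and>
        (\<exists>K. compact K \<and> (\<forall>k. spt m (S k) \<subseteq> K)) \<and>
        summable (\<lambda>k. real_of_ereal (normal_mass m (S k)) powr (1 - \<alpha>) *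
                      real_of_ereal (normal_flat_norm m (S k)) powr \<alpha>) \<and>
        (\<lambda>n. flat_norm m (\<lambda>\<omega>. T \<omega> - (\<Sum>k<n. S k \<omega>))) \<longlonglongrightarrow> 0)"

section \<open>The current of integration over an open set\<close>

text \<open>
  \<open>\<real>\<^sup>d\<close> is \<open>real ^ 'n\<close> with \<open>d = CARD('n)\<close>; the linear order on \<open>'n\<close> fixes the order of the
  coordinates.  A \<open>d\<close>-form \<open>\<omega> = g dx\<^sub>1 \<and> \<dots> \<and> dx\<^sub>d\<close> has \<open>g x = \<omega> x [e\<^sub>1,\<dots>,e\<^sub>d]\<close>.
\<close>

definition std_basis :: "(real ^ 'n::{finite,linorder}) list" where
  "std_basis = map (\<lambda>i. axis i 1) (sorted_list_of_set UNIV)"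

definition solid_current :: "(real ^ 'n::{finite,linorder}) set \<Rightarrow> (real ^ 'n::{finite,linorder}) functional" where
  "solid_current U = (\<lambda>\<omega>. LINT x:U|lborel. \<omega> x std_basis)"

section \<open>Summable sets\<close>

definition dyadic_cubes :: "int \<Rightarrow> (real ^ 'n::finite) set set" where
  "dyadic_cubes k = {cbox (\<chi> i. of_int (l i) * 2 powi (- k)) (\<chi> i. (of_int (l i) + 1) * 2 powi (- k))
     | l :: 'n \<Rightarrow> int. True}"

definition dyadic_count :: "(real ^ 'n::finite) set \<Rightarrow> int \<Rightarrow> nat" where
  "dyadic_count A k = card {Q \<in> dyadic_cubes k. Q \<inter> A \<noteq> {}}"

definition summable_set :: "real \<Rightarrow> (real ^ 'n::finite) set \<Rightarrow> bool" where
  "summable_set s A \<longleftrightarrow> bounded A \<and>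
     summable (\<lambda>k::nat. real (dyadic_count A (int k)) * 2 powr (- (real k * s)))"

end

theory Submission
  imports Defs
begin

text \<open>
  Exhaust \<open>U\<close> by the sets \<open>W\<^sub>k\<close> made of the dyadic \<open>k\<close>-cubes contained in \<open>U\<close> and decompose \<open>U\<close> into
  the layers \<open>W\<^sub>k\<^sub>+\<^sub>1 - W\<^sub>k\<close>.  A layer consists of at most \<open>2\<^sup>d N(k)\<close> cubes of side \<open>2\<^sup>-\<^sup>k\<^sup>-\<^sup>1\<close>, where \<open>N(k)\<close> counts the
  \<open>k\<close>-cubes meeting \<open>\<partial>U\<close>.  Hence its flat norm, bounded by its volume, is at most \<open>N(k) 2\<^sup>-\<^sup>k\<^sup>d\<close>, its
  normal mass is at most a constant times \<open>N(k) 2\<^sup>-\<^sup>k\<^sup>(\<^sup>d\<^sup>-\<^sup>1\<^sup>)\<close>, and interpolating the two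
  gives a constant times \<open>N(k) 2\<^sup>-\<^sup>k\<^sup>(\<^sup>d\<^sup>-\<^sup>1\<^sup>+\<^sup>\<alpha>\<^sup>)\<close>, which is summable by hypothesis.
\<close>

section \<open>Forms, mass and flat norm\<close>

text \<open>Two notions resist direct estimation. \<open>flat_norm\<close> is a definite description
  over approximating sequences, so a remainder of the series has a usable norm only after such a
  sequence is exhibited for it and the norm is identified with the supremum over test forms. That
  supremum is at most the mass, which for a solid current is at most a volume. The boundary mass is
  a supremum over all (d-1)-forms of comass at most 1, but only their d components along coordinate
  vectors enter. Each component tests a directional derivative of the indicator function, and this
  is controlled by the volume that a small translation changes. Both estimates are linear in the
  number of cells, so the exponents 1 - \<alpha> and \<alpha> leave the first power of N(k), while
  the powers of the side length combine to d - 1 + \<alpha>. This is the origin of the exponent in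
  the hypothesis.\<close>

lemma simple_norm_distinct_Basis:
  assumes "distinct vs" "set vs \<subseteq> Basis"
  shows "simple_norm vs = 1"
proof -
  \<comment> \<open>The Gram matrix is the identity, so in the Leibniz expansion a permutation that
    moves some index picks up a zero factor.\<close>
  have gram: "(\<Prod>i<length vs. vs ! i \<bullet> vs ! p i) = (if p = id then 1 else 0)"
    if p: "p permutes {..<length vs}" for p
  proof (cases "p = id")
    case True
    have "vs ! i \<bullet> vs ! i = 1" if "i < length vs" for i
      using that assms(2) by (meson inner_same_Basis nth_mem subsetD)
    with True show ?thesis by simp
  next
    case False
    then obtain i where i: "p i \<noteq> i" by fastforce
    have "i < length vs" using i permutes_not_in[OF p] by blast
    moreover have "p i < length vs" using permutes_in_image[OF p, of i] calculation by simp
    ultimately have "vs ! i \<bullet> vs ! p i = 0"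
      using i assms by (metis inner_not_same_Basis nth_eq_iff_index_eq nth_mem subsetD)
    with \<open>i < length vs\<close> show ?thesis using False by auto
  qed
  have "(\<Sum>p | p permutes {..<length vs}. of_int (sign p) * (\<Prod>i<length vs. vs ! i \<bullet> vs ! p i))
      = (\<Sum>p | p permutes {..<length vs}. if p = id then 1 else 0 :: real)"
    by (rule sum.cong) (auto simp: gram)
  also have "\<dots> = 1"
    by (subst sum.delta) (auto simp: finite_permutations permutes_id)
  finally show ?thesis by (simp add: simple_norm_def)
qed

lemma form_le_comass_sup:
  assumes "length vs = m" "simple_norm vs \<le> 1"
  shows "ereal \<bar>\<omega> x vs\<bar> \<le> comass_sup m \<omega>"
proof -
  have "ereal \<bar>\<omega> x vs\<bar> \<le> comass m (\<omega> x)"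
    unfolding comass_def using assms by (intro SUP_upper) auto
  also have "\<dots> \<le> comass_sup m \<omega>" unfolding comass_sup_def by (intro SUP_upper) auto
  finally show ?thesis .
qed

text \<open>This is all that the proof extracts from a comass bound. It serves for the full
  coordinate frame in the mass and for the frame with one vector removed in the boundary
  mass.\<close>

lemma abs_form_le_one:
  assumes "comass_sup m \<omega> \<le> 1" "length vs = m" "distinct vs" "set vs \<subseteq> Basis"
  shows "\<bar>\<omega> x vs\<bar> \<le> 1"
  using order_trans[OF form_le_comass_sup assms(1)] simple_norm_distinct_Basis assms by fastforce

lemma length_std_basis [simp]:
  "length (std_basis :: (real ^ 'n::{finite,linorder}) list) = CARD('n)"
  by (simp add: std_basis_def)

lemma distinct_std_basis [simp]: "distinct (std_basis :: (real ^ 'n::{finite,linorder}) list)"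
  by (auto simp: std_basis_def distinct_map inj_on_def axis_eq_axis)

lemma set_std_basis_subset: "set (std_basis :: (real ^ 'n::{finite,linorder}) list) \<subseteq> Basis"
  by (auto simp: std_basis_def Basis_vec_def)

lemma smooth_differentiable: "smooth f \<Longrightarrow> f differentiable (at x)"
  unfolding smooth_def by (metis iter_deriv.simps(1))

lemma smooth_continuous_on: "smooth f \<Longrightarrow> continuous_on A f"
  by (meson continuous_at_imp_continuous_on differentiable_imp_continuous_within smooth_differentiable)

lemma smooth_iter_deriv: "smooth f \<Longrightarrow> smooth (iter_deriv ws f)"
proof -
  have "iter_deriv vs (iter_deriv ws f) = iter_deriv (vs @ ws) f" for vs
    by (induction vs) auto
  then show "smooth f \<Longrightarrow> smooth (iter_deriv ws f)" by (simp add: smooth_def)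
qed

lemma continuous_on_frechet_derivative_smooth:
  assumes "smooth f"
  shows "continuous_on A (\<lambda>x. frechet_derivative f (at x) e)"
  using smooth_continuous_on[OF smooth_iter_deriv[OF assms, of "[e]"]] by simp

lemma smooth_formsD: "\<omega> \<in> smooth_forms m \<Longrightarrow> smooth (\<lambda>x. \<omega> x vs)"
  by (simp add: smooth_forms_def)

lemma zero_smooth_form: "(\<lambda>x vs. 0) \<in> smooth_forms m"
proof -
  have "iter_deriv ws (\<lambda>x::'a. 0) = (\<lambda>x. 0)" for ws by (induction ws) auto
  then have "smooth (\<lambda>x::'a. 0)" by (simp add: smooth_def)
  then show ?thesis by (simp add: smooth_forms_def covectors_def linear_zero)
qed

lemma comass_sup_zero_le: "comass_sup m (\<lambda>x vs. 0) \<le> 1"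
  by (simp add: comass_sup_def comass_def SUP_least)

lemma ext_deriv_zero: "ext_deriv (\<lambda>x vs. 0) = (\<lambda>x vs. 0)"
  by (simp add: ext_deriv_def)

text \<open>The zero form is an admissible test. The lower bound matters because
  \<open>fractional\<close> passes to reals by \<open>real_of_ereal\<close>.\<close>

lemma mass_nonneg:
  assumes "T (\<lambda>x vs. 0) = 0"
  shows "0 \<le> mass m T"
  unfolding mass_def
  by (rule SUP_upper2[of "\<lambda>x vs. 0"]) (auto simp: assms zero_smooth_form comass_sup_zero_le)

lemma normal_flat_norm_nonneg:
  assumes "T (\<lambda>x vs. 0) = 0"
  shows "0 \<le> normal_flat_norm m T"
  unfolding normal_flat_norm_def
  by (rule SUP_upper2[of "\<lambda>x vs. 0"])
    (auto simp: assms zero_smooth_form comass_sup_zero_le ext_deriv_zero)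

lemma current_zero: "current m T \<Longrightarrow> T (\<lambda>x vs. 0) = 0"
proof -
  assume "current m T"
  then have "\<forall>\<omega>\<in>smooth_forms m. \<forall>c. T (\<lambda>x vs. c * \<omega> x vs) = c * T \<omega>"
    unfolding current_def by (elim conjE)
  from bspec[OF this zero_smooth_form, THEN spec, of 0] show ?thesis by simp
qed

lemma normal_flat_norm_le_mass: "normal_flat_norm m T \<le> mass m T"
  unfolding normal_flat_norm_def mass_def by (rule SUP_subset_mono) auto

text \<open>Functionals are total functions, so two that are equal as currents may differ off the
  smooth forms. The remainders of the series agree with solid currents only in this sense.\<close>

lemma normal_flat_norm_cong:
  assumes "\<And>\<omega>. \<omega> \<in> smooth_forms m \<Longrightarrow> T \<omega> = T' \<omega>"
  shows "normal_flat_norm m T = normal_flat_norm m T'"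
  unfolding normal_flat_norm_def by (rule SUP_cong) (auto simp: assms)

text \<open>
  Evaluating the duality formula at the limit current costs nothing, because the Cauchy estimate is
  uniform over the test forms.  Hence the limit in the definition of the flat norm exists and does
  not depend on the approximating sequence.
\<close>

lemma flat_approx_tendsto:
  fixes S :: "nat \<Rightarrow> 'a::euclidean_space functional"
  assumes "flat_approx m S T"
  shows "(\<lambda>n. normal_flat_norm m (S n)) \<longlonglongrightarrow> normal_flat_norm m T"
proof (rule order_tendstoI)
  \<comment> \<open>Lower semicontinuity: a single nearly optimal test form for \<open>T\<close>
    works for all late \<open>S n\<close>.\<close>
  fix a assume "a < normal_flat_norm m T"
  then obtain \<omega> where w: "\<omega> \<in> smooth_forms m"
      "max (comass_sup m \<omega>) (comass_sup (Suc m) (ext_deriv \<omega>)) \<le> 1" "a < ereal (T \<omega>)"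
    unfolding normal_flat_norm_def by (auto simp: less_SUP_iff)
  have "(\<lambda>n. ereal (S n \<omega>)) \<longlonglongrightarrow> ereal (T \<omega>)"
    using assms w(1) unfolding flat_approx_def by simp
  then have "\<forall>\<^sub>F n in sequentially. a < ereal (S n \<omega>)"
    using w(3) by (rule order_tendstoD(1))
  then show "\<forall>\<^sub>F n in sequentially. a < normal_flat_norm m (S n)"
  proof eventually_elim
    case (elim n)
    have "ereal (S n \<omega>) \<le> normal_flat_norm m (S n)"
      unfolding normal_flat_norm_def by (rule SUP_upper) (use w in auto)
    with elim show ?case by order
  qed
next
  fix a assume a: "normal_flat_norm m T < a"
  have lim: "(\<lambda>n. S n \<omega>) \<longlonglongrightarrow> T \<omega>" if "\<omega> \<in> smooth_forms m" for \<omega> :: "'a form"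
    using assms that unfolding flat_approx_def by simp
  have "current m (S n)" for n
    using assms unfolding flat_approx_def normal_current_def by simp
  then have "S n (\<lambda>x vs. 0) = 0" for n by (rule current_zero)
  then have "T (\<lambda>x vs. 0) = 0"
    using LIMSEQ_unique[OF lim[OF zero_smooth_form]] by simp
  then have "0 \<le> normal_flat_norm m T" by (rule normal_flat_norm_nonneg)
  with a obtain r where r: "normal_flat_norm m T = ereal r"
    by (cases "normal_flat_norm m T") auto
  obtain e where e: "e > 0" "ereal (r + e) < a"
  proof (cases a)
    case (real b)
    then show ?thesis using a r that[of "(b - r) / 2"] by (simp add: field_simps)
  next
    case PInf
    then show ?thesis using that[of 1] by simp
  next
    case MInf
    then show ?thesis using a by simp
  qed
  obtain N where N: "\<And>i j. i \<ge> N \<Longrightarrow> j \<ge> N \<Longrightarrow> normal_flat_norm m (\<lambda>\<omega>. S i \<omega> - S j \<omega>) < ereal e"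
    using assms e(1) unfolding flat_approx_def by meson
  \<comment> \<open>Letting \<open>j\<close> tend to infinity in the Cauchy estimate, for a fixed
    form, compares \<open>S n\<close> with \<open>T\<close> up to \<open>e\<close>.\<close>
  have "normal_flat_norm m (S n) < a" if n: "n \<ge> N" for n
  proof -
    have "normal_flat_norm m (S n) \<le> ereal (r + e)"
      unfolding normal_flat_norm_def
    proof (rule SUP_least)
      fix \<omega> :: "'a form"
      assume w: "\<omega> \<in> {\<omega> \<in> smooth_forms m.
        max (comass_sup m \<omega>) (comass_sup (Suc m) (ext_deriv \<omega>)) \<le> 1}"
      have "S n \<omega> - S j \<omega> \<le> e" if "j \<ge> N" for j
      proof -
        have "ereal (S n \<omega> - S j \<omega>) \<le> normal_flat_norm m (\<lambda>\<omega>. S n \<omega> - S j \<omega>)"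
          unfolding normal_flat_norm_def by (rule SUP_upper) (use w in auto)
        with N[OF n that] have "ereal (S n \<omega> - S j \<omega>) < ereal e" by order
        then show ?thesis by simp
      qed
      moreover have "(\<lambda>j. S n \<omega> - S j \<omega>) \<longlonglongrightarrow> S n \<omega> - T \<omega>"
        using w by (intro tendsto_intros lim) auto
      ultimately have "S n \<omega> - T \<omega> \<le> e" by (intro LIMSEQ_le_const2) auto
      moreover have "ereal (T \<omega>) \<le> normal_flat_norm m T"
        unfolding normal_flat_norm_def by (rule SUP_upper) (use w in auto)
      ultimately show "ereal (S n \<omega>) \<le> ereal (r + e)" using r by auto
    qed
    with e(2) show ?thesis by order
  qed
  then show "\<forall>\<^sub>F n in sequentially. normal_flat_norm m (S n) < a"
    by (auto simp: eventually_sequentially)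
qed

lemma flat_norm_eq:
  assumes "flat_approx m S T"
  shows "flat_norm m T = normal_flat_norm m T"
  unfolding flat_norm_def
proof (rule the_equality)
  show "\<exists>S. flat_approx m S T \<and> (\<lambda>n. normal_flat_norm m (S n)) \<longlonglongrightarrow> normal_flat_norm m T"
    using assms flat_approx_tendsto by blast
next
  fix L assume "\<exists>S. flat_approx m S T \<and> (\<lambda>n. normal_flat_norm m (S n)) \<longlonglongrightarrow> L"
  then show "L = normal_flat_norm m T" using flat_approx_tendsto LIMSEQ_unique by blast
qed

section \<open>Integrals of continuous functions over bounded Borel sets\<close>

lemma set_integrable_bounded_continuous:
  fixes g :: "'a::euclidean_space \<Rightarrow> real"
  assumes "A \<in> sets borel" "bounded A" "continuous_on UNIV g"
  shows "set_integrable lborel A g"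
proof (rule set_integrable_subset)
  show "set_integrable lborel (closure A) g"
    unfolding set_integrable_def
    using assms(2,3) by (intro borel_integrable_compact) (auto intro: continuous_on_subset)
qed (use assms closure_subset in auto)

lemma abs_set_integral_le:
  fixes g :: "'a::euclidean_space \<Rightarrow> real"
  assumes "A \<in> sets borel" "bounded A" "continuous_on UNIV g" "\<And>x. x \<in> A \<Longrightarrow> \<bar>g x\<bar> \<le> c"
  shows "\<bar>LINT x:A|lborel. g x\<bar> \<le> c * measure lborel A"
proof -
  note int = set_integrable_bounded_continuous[OF assms(1,2)]
  have "\<bar>LINT x:A|lborel. g x\<bar> \<le> (LINT x:A|lborel. \<bar>g x\<bar>)"
    using set_integral_norm_bound[OF int[OF assms(3)]] by simp
  also have "\<dots> \<le> (LINT x:A|lborel. c)"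
    using assms(3,4) by (intro set_integral_mono int continuous_intros) auto
  also have "\<dots> = c * measure lborel A"
    using assms(1) emeasure_bounded_finite[OF assms(2)] by (simp add: set_integral_const)
  finally show ?thesis .
qed

lemma set_integral_Diff_subset:
  fixes g :: "'a::euclidean_space \<Rightarrow> real"
  assumes "A \<in> sets borel" "B \<in> sets borel" "bounded A" "B \<subseteq> A" "continuous_on UNIV g"
  shows "(LINT x:A - B|lborel. g x) = (LINT x:A|lborel. g x) - (LINT x:B|lborel. g x)"
proof -
  have "bounded (A - B)" "bounded B" using assms(3,4) bounded_subset by blast+
  then have "(LINT x:(A - B) \<union> B|lborel. g x) = (LINT x:A - B|lborel. g x) + (LINT x:B|lborel. g x)"
    using assms by (intro set_integral_Un set_integrable_bounded_continuous) auto
  moreover have "(A - B) \<union> B = A" using assms(4) by blast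
  ultimately show ?thesis by simp
qed

section \<open>Currents of integration\<close>

text \<open>Continuity needs only the seminorm of order 0 over the compact set
  \<open>closure A\<close>, because the integral is bounded by the volume times the supremum of the
  coefficient.\<close>

lemma current_solid_current:
  fixes A :: "(real ^ 'n::{finite,linorder}) set"
  assumes "A \<in> sets borel" "bounded A"
  shows "current CARD('n) (solid_current A)"
proof -
  let ?m = "CARD('n)"
  note int = set_integrable_bounded_continuous[OF assms smooth_continuous_on[OF smooth_formsD]]
  have top: "topspace (form_topology ?m :: (real, 'n) vec form topology) = smooth_forms ?m"
  proof -
    have "\<omega> \<in> \<Union>{form_ball ?m K k \<epsilon> \<omega> | K k \<epsilon> \<omega>. compact K \<and> 0 < \<epsilon> \<and> \<omega> \<in> smooth_forms ?m}"
      if "\<omega> \<in> smooth_forms ?m" for \<omega> :: "(real, 'n) vec form"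
    proof (rule UnionI)
      \<comment> \<open>Over the empty compact set the ball condition is vacuous.\<close>
      show "\<omega> \<in> form_ball ?m {} 0 1 \<omega>" using that by (simp add: form_ball_def)
      show "form_ball ?m {} 0 1 \<omega> \<in>
          {form_ball ?m K k \<epsilon> \<omega> | K k \<epsilon> \<omega>. compact K \<and> 0 < \<epsilon> \<and> \<omega> \<in> smooth_forms ?m}"
        using that by (intro CollectI exI conjI) auto
    qed
    then show ?thesis
      by (auto simp: form_topology_def form_ball_def)
  qed
  have "openin (form_topology ?m) {\<omega> \<in> smooth_forms ?m. solid_current A \<omega> \<in> V}"
    if V: "open V" for V
  proof (subst openin_subopen, intro ballI)
    fix \<omega> :: "(real, 'n) vec form"
    assume "\<omega> \<in> {\<omega> \<in> smooth_forms ?m. solid_current A \<omega> \<in> V}"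
    then have w: "\<omega> \<in> smooth_forms ?m" "solid_current A \<omega> \<in> V" by auto
    obtain e where e: "e > 0" "\<And>y. dist y (solid_current A \<omega>) < e \<Longrightarrow> y \<in> V"
      using V w(2) open_dist by blast
    \<comment> \<open>Adding 1 keeps the denominator positive for null sets and makes the bound by
      \<open>e\<close> strict.\<close>
    define \<delta> where "\<delta> = e / (measure lborel A + 1)"
    have \<delta>: "\<delta> > 0" "\<delta> * measure lborel A < e"
      using e(1) measure_nonneg[of lborel A]
      by (simp_all add: \<delta>_def pos_divide_less_eq add_nonneg_pos del: measure_nonneg)
    let ?B = "form_ball ?m (closure A) 0 \<delta> \<omega>"
    have "solid_current A \<eta> \<in> V" if "\<eta> \<in> ?B" for \<eta>
    proof (rule e(2))
      have \<eta>: "\<eta> \<in> smooth_forms ?m" using that by (simp add: form_ball_def)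
      have "\<bar>\<eta> x std_basis - \<omega> x std_basis\<bar> \<le> \<delta>" if "x \<in> A" for x
      proof -
        have "x \<in> closure A" using that closure_subset by blast
        then have "\<bar>iter_deriv ws (\<lambda>y. \<eta> y vs - \<omega> y vs) x\<bar> < \<delta>"
          if "set vs \<subseteq> Basis" "length vs = ?m" "set ws \<subseteq> Basis" "length ws \<le> 0" for vs ws
          using \<open>\<eta> \<in> ?B\<close> that unfolding form_ball_def by blast
        from this[of std_basis "[]"] have "\<bar>iter_deriv [] (\<lambda>y. \<eta> y std_basis - \<omega> y std_basis) x\<bar> < \<delta>"
          using set_std_basis_subset by simp
        then show ?thesis by simp
      qed
      then have "\<bar>LINT x:A|lborel. \<eta> x std_basis - \<omega> x std_basis\<bar> \<le> \<delta> * measure lborel A"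
        using \<eta> w(1) by (intro abs_set_integral_le assms continuous_on_diff smooth_continuous_on)
          (auto intro: smooth_formsD)
      then show "dist (solid_current A \<eta>) (solid_current A \<omega>) < e"
        using \<delta>(2) by (simp add: dist_real_def solid_current_def set_integral_diff(2)[OF int[OF \<eta>] int[OF w(1)]])
    qed
    moreover have "openin (form_topology ?m) ?B"
      unfolding form_topology_def
      using assms(2) \<delta>(1) w(1) by (intro topology_generated_by_Basis CollectI exI conjI) auto
    moreover have "\<omega> \<in> ?B" using w(1) \<delta>(1) by (simp add: form_ball_def)
    moreover have "?B \<subseteq> smooth_forms ?m" by (auto simp: form_ball_def)
    ultimately show "\<exists>T. openin (form_topology ?m) T \<and> \<omega> \<in> T \<and>
        T \<subseteq> {\<omega> \<in> smooth_forms ?m. solid_current A \<omega> \<in> V}"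
      by blast
  qed
  then have "continuous_map (form_topology ?m) euclideanreal (solid_current A)"
    by (auto simp: continuous_map_def top)
  then show ?thesis
    unfolding current_def using int by (simp add: solid_current_def set_integral_add(2))
qed

lemma abs_solid_current_le:
  fixes A :: "(real ^ 'n::{finite,linorder}) set"
  assumes "A \<in> sets borel" "bounded A" "\<omega> \<in> smooth_forms CARD('n)" "comass_sup CARD('n) \<omega> \<le> 1"
  shows "\<bar>solid_current A \<omega>\<bar> \<le> measure lborel A"
  using abs_set_integral_le[OF assms(1,2) smooth_continuous_on[OF smooth_formsD[OF assms(3)]], of std_basis 1]
    abs_form_le_one[OF assms(4) length_std_basis distinct_std_basis set_std_basis_subset]
  by (simp add: solid_current_def)

lemma mass_solid_current_le:
  fixes A :: "(real ^ 'n::{finite,linorder}) set"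
  assumes "A \<in> sets borel" "bounded A"
  shows "mass CARD('n) (solid_current A) \<le> measure lborel A"
  unfolding mass_def
proof (rule SUP_least)
  fix \<omega> :: "(real, 'n) vec form"
  assume "\<omega> \<in> {\<omega> \<in> smooth_forms CARD('n). comass_sup CARD('n) \<omega> \<le> 1}"
  then have "\<bar>solid_current A \<omega>\<bar> \<le> measure lborel A" using abs_solid_current_le[OF assms] by blast
  then show "ereal (solid_current A \<omega>) \<le> measure lborel A" by simp
qed

lemma spt_solid_current:
  fixes A :: "(real ^ 'n::{finite,linorder}) set"
  shows "spt CARD('n) (solid_current A) \<subseteq> closure A"
proof -
  have "solid_current A \<omega> = 0" if "form_support \<omega> \<subseteq> - closure A" for \<omega>
  proof -
    have "\<omega> x std_basis = 0" if "x \<in> A" for x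
    proof (rule ccontr)
      assume "\<omega> x std_basis \<noteq> 0"
      then have "x \<in> form_support \<omega>"
        unfolding form_support_def using closure_subset by fastforce
      with that \<open>form_support \<omega> \<subseteq> - closure A\<close> show False using closure_subset by blast
    qed
    then show ?thesis
      unfolding solid_current_def set_lebesgue_integral_def
      by (intro integral_eq_zero_AE) (auto simp: indicator_def)
  qed
  then show ?thesis unfolding spt_def by blast
qed

lemma solid_current_Diff:
  fixes A :: "(real ^ 'n::{finite,linorder}) set"
  assumes "A \<in> sets borel" "B \<in> sets borel" "bounded A" "B \<subseteq> A" "\<omega> \<in> smooth_forms m"
  shows "solid_current (A - B) \<omega> = solid_current A \<omega> - solid_current B \<omega>"
  unfolding solid_current_def
  using assms by (intro set_integral_Diff_subset smooth_continuous_on smooth_formsD[of \<omega> m])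

lemma measure_Diff_incseq_tendsto_0:
  fixes A :: "nat \<Rightarrow> 'a::euclidean_space set"
  assumes "incseq A" "\<And>n. A n \<in> sets borel" "bounded (\<Union>n. A n)"
  shows "(\<lambda>n. measure lborel ((\<Union>n. A n) - A n)) \<longlonglongrightarrow> 0"
proof -
  let ?A = "\<Union>n. A n"
  have A: "?A \<in> sets borel" using assms(2) by auto
  have fin: "emeasure lborel ?A < \<infinity>" using assms(3) by (rule emeasure_bounded_finite)
  have "(\<lambda>n. measure lborel ?A - measure lborel (A n)) \<longlonglongrightarrow> measure lborel ?A - measure lborel ?A"
    using assms(1,2) fin by (intro tendsto_intros Lim_measure_incseq) auto
  moreover have "measure lborel (?A - A n) = measure lborel ?A - measure lborel (A n)" for n
    using assms(2) A fin by (intro measure_Diff) auto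
  ultimately show ?thesis by simp
qed

text \<open>For indices beyond \<open>N\<close> two of the sets differ only inside the union minus
  \<open>A N\<close>, whose volume tends to 0; this gives the Cauchy condition. \<open>T\<close> is
  prescribed on smooth forms only, so that differences of functionals are covered too.\<close>

lemma flat_approx_solid_current:
  fixes A :: "nat \<Rightarrow> (real ^ 'n::{finite,linorder}) set"
  assumes "incseq A" "\<And>n. A n \<in> sets borel" "bounded (\<Union>n. A n)"
    and "\<And>n. normal_current CARD('n) (solid_current (A n))"
    and "\<And>\<omega>. \<omega> \<in> smooth_forms CARD('n) \<Longrightarrow> T \<omega> = solid_current (\<Union>n. A n) \<omega>"
  shows "flat_approx CARD('n) (\<lambda>n. solid_current (A n)) T"
proof -
  let ?A = "\<Union>n. A n" and ?m = "CARD('n)"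
  have bdd: "bounded (A n)" for n by (rule bounded_subset[OF assms(3)]) auto
  have fin: "emeasure lborel B < \<infinity>" if "B \<subseteq> ?A" for B
    using assms(3) bounded_subset that emeasure_bounded_finite by blast
  have A: "?A \<in> sets borel" using assms(2) by auto
  have tail: "(\<lambda>n. measure lborel (?A - A n)) \<longlonglongrightarrow> 0"
    by (rule measure_Diff_incseq_tendsto_0[OF assms(1-3)])
  have diff: "\<bar>solid_current (A i) \<omega> - solid_current (A j) \<omega>\<bar> \<le> measure lborel (?A - A N)"
    if "\<omega> \<in> smooth_forms ?m" "comass_sup ?m \<omega> \<le> 1" "i \<ge> N" "j \<ge> N" for i j N \<omega>
    using that(3,4)
  proof (induction i j rule: linorder_wlog)
    case (le i j)
    have "A i \<subseteq> A j" "A N \<subseteq> A i" using le assms(1) by (auto dest: incseqD)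
    then have "\<bar>solid_current (A j) \<omega> - solid_current (A i) \<omega>\<bar> = \<bar>solid_current (A j - A i) \<omega>\<bar>"
      using solid_current_Diff assms(2) bdd that(1) by metis
    also have "\<dots> \<le> measure lborel (A j - A i)"
      using assms(2) bdd that by (intro abs_solid_current_le) (auto intro: bounded_subset)
    also have "\<dots> \<le> measure lborel (?A - A N)"
      using \<open>A N \<subseteq> A i\<close> assms(2) fin[of "?A - A N"] A by (intro measure_mono_fmeasurable)
        (auto simp: fmeasurable_def)
    finally show ?case by (simp add: abs_minus_commute)
  next
    case (sym i j)
    then show ?case by (simp add: abs_minus_commute)
  qed
  have cauchy: "\<exists>N. \<forall>i\<ge>N. \<forall>j\<ge>N.
      normal_flat_norm ?m (\<lambda>\<omega>. solid_current (A i) \<omega> - solid_current (A j) \<omega>) < ereal \<epsilon>"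
    if "\<epsilon> > 0" for \<epsilon>
  proof -
    obtain N where N: "measure lborel (?A - A N) < \<epsilon>"
      using order_tendstoD(2)[OF tail \<open>\<epsilon> > 0\<close>] by (auto simp: eventually_sequentially)
    have "normal_flat_norm ?m (\<lambda>\<omega>. solid_current (A i) \<omega> - solid_current (A j) \<omega>) < ereal \<epsilon>"
      if "i \<ge> N" "j \<ge> N" for i j
    proof -
      have "normal_flat_norm ?m (\<lambda>\<omega>. solid_current (A i) \<omega> - solid_current (A j) \<omega>)
          \<le> ereal (measure lborel (?A - A N))"
        unfolding normal_flat_norm_def
      proof (rule SUP_least)
        fix \<omega> :: "(real, 'n) vec form"
        assume "\<omega> \<in> {\<omega> \<in> smooth_forms ?m.
          max (comass_sup ?m \<omega>) (comass_sup (Suc ?m) (ext_deriv \<omega>)) \<le> 1}"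
        then have "\<bar>solid_current (A i) \<omega> - solid_current (A j) \<omega>\<bar> \<le> measure lborel (?A - A N)"
          using that by (intro diff) auto
        then show "ereal (solid_current (A i) \<omega> - solid_current (A j) \<omega>)
            \<le> ereal (measure lborel (?A - A N))" by simp
      qed
      also have "\<dots> < ereal \<epsilon>" using N by simp
      finally show ?thesis .
    qed
    then show ?thesis by blast
  qed
  have "spt ?m (solid_current (A n)) \<subseteq> closure ?A" for n
    using spt_solid_current[of "A n"] closure_mono[of "A n" ?A] by blast
  then have "(\<Union>n. spt ?m (solid_current (A n))) \<subseteq> closure ?A" by blast
  then have "compact (closure (\<Union>n. spt ?m (solid_current (A n))))"
    using assms(3) bounded_closure bounded_subset by (metis compact_closure)
  moreover have "(\<lambda>n. solid_current (A n) \<omega>) \<longlonglongrightarrow> T \<omega>" if w: "\<omega> \<in> smooth_forms ?m" for \<omega>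
  proof -
    note cont = smooth_continuous_on[OF smooth_formsD[OF w, of std_basis]]
    \<comment> \<open>Weak convergence concerns arbitrary smooth forms, without a comass bound, so
      the constant depends on the form; compactness of the closure provides it.\<close>
    obtain c where c: "\<And>x. x \<in> ?A \<Longrightarrow> \<bar>\<omega> x std_basis\<bar> \<le> c"
    proof -
      have "bounded ((\<lambda>x. \<omega> x std_basis) ` closure ?A)"
        using cont assms(3) by (intro compact_imp_bounded compact_continuous_image) auto
      then show ?thesis
        using that closure_subset unfolding bounded_iff by (metis image_eqI real_norm_def subsetD)
    qed
    have "\<bar>solid_current (A n) \<omega> - T \<omega>\<bar> \<le> c * measure lborel (?A - A n)" for n
    proof -
      have "solid_current (?A - A n) \<omega> = T \<omega> - solid_current (A n) \<omega>"
        unfolding assms(5)[OF w] by (rule solid_current_Diff[OF A assms(2,3) _ w]) auto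
      moreover have "\<bar>solid_current (?A - A n) \<omega>\<bar> \<le> c * measure lborel (?A - A n)"
        unfolding solid_current_def using A assms(2,3) c w
        by (intro abs_set_integral_le smooth_continuous_on smooth_formsD)
          (auto intro: bounded_subset)
      ultimately show ?thesis by (simp add: abs_minus_commute)
    qed
    then have "(\<lambda>n. solid_current (A n) \<omega> - T \<omega>) \<longlonglongrightarrow> 0"
      by (intro Lim_null_comparison[OF _ tendsto_mult_right_zero[OF tail, of c]]) auto
    then show ?thesis by (simp add: LIM_zero_iff)
  qed
  ultimately show ?thesis
    unfolding flat_approx_def using cauchy assms(4) by auto
qed

section \<open>Perimeter bounds\<close>

text \<open>A bound on the variation of the indicator function in each coordinate direction
  separately. Scalar tests suffice because the boundary pairing splits into one scalar component per
  direction. Compact support is not imposed on \<open>f\<close>, so components of arbitrary smooth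
  forms can be inserted directly.\<close>

definition perimeter_le :: "'a::euclidean_space set \<Rightarrow> real \<Rightarrow> bool" where
  "perimeter_le A p \<longleftrightarrow> (\<forall>f e. smooth f \<longrightarrow> (\<forall>x. \<bar>f x\<bar> \<le> 1) \<longrightarrow> e \<in> Basis \<longrightarrow>
     \<bar>LINT x:A|lborel. frechet_derivative f (at x) e\<bar> \<le> p)"

lemma smooth_has_real_derivative_line:
  assumes "smooth f"
  shows "((\<lambda>t. f (x + t *\<^sub>R e)) has_real_derivative frechet_derivative f (at (x + t *\<^sub>R e)) e) (at t)"
proof -
  let ?D = "frechet_derivative f (at (x + t *\<^sub>R e))"
  have f: "(f has_derivative ?D) (at (x + t *\<^sub>R e))"
    using smooth_differentiable[OF assms] frechet_derivative_works by blast
  have "((\<lambda>t. x + t *\<^sub>R e) has_derivative (\<lambda>s. s *\<^sub>R e)) (at t)"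
    by (auto intro!: derivative_eq_intros)
  from has_derivative_compose[OF this f] have
    "((\<lambda>t. f (x + t *\<^sub>R e)) has_derivative (\<lambda>s. ?D (s *\<^sub>R e))) (at t)" .
  moreover have "(\<lambda>s. ?D (s *\<^sub>R e)) = (*) (?D e)"
    using has_derivative_linear[OF f] by (auto simp: linear_cmul mult.commute)
  ultimately show ?thesis by (simp add: has_field_derivative_def)
qed

lemma set_integral_translation:
  fixes f :: "'a::euclidean_space \<Rightarrow> real"
  assumes "A \<in> sets borel" "continuous_on UNIV f"
  shows "(LINT x:A|lborel. f (x + v)) = (LINT y:{y. y - v \<in> A}|lborel. f y)"
proof -
  have [measurable]: "A \<in> sets borel" "f \<in> borel_measurable borel"
    using assms by (auto intro: borel_measurable_continuous_onI)
  have "(LINT y:{y. y - v \<in> A}|lborel. f y)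
      = integral\<^sup>L (distr lborel borel ((+) v)) (\<lambda>y. indicator A (y - v) *\<^sub>R f y)"
    by (simp add: lborel_distr_plus set_lebesgue_integral_def indicator_def)
  also have "\<dots> = (LINT x:A|lborel. f (x + v))"
    by (subst integral_distr) (simp_all add: set_lebesgue_integral_def add.commute)
  finally show ?thesis by simp
qed

text \<open>
  No Fubini or divergence theorem is needed: the difference quotients of \<open>f\<close> converge boundedly,
  and integrating one of them over \<open>A\<close> compares the integrals of \<open>f\<close> over \<open>A\<close> and over a translate.
\<close>

lemma perimeter_leI_translation:
  fixes A :: "'a::euclidean_space set"
  assumes A: "A \<in> sets borel" "bounded A"
    and shift: "\<And>e h. e \<in> Basis \<Longrightarrow> 0 < h \<Longrightarrow>
      measure lborel {y. (y - h *\<^sub>R e \<in> A) \<noteq> (y \<in> A)} \<le> h * p"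
  shows "perimeter_le A p"
  unfolding perimeter_le_def
proof (intro allI impI)
  fix f :: "'a \<Rightarrow> real" and e :: 'a
  assume f: "smooth f" and le1: "\<forall>x. \<bar>f x\<bar> \<le> 1" and e: "e \<in> Basis"
  define f' where "f' = (\<lambda>x. frechet_derivative f (at x) e)"
  define h where "h = (\<lambda>n. inverse (real (Suc n)))"
  define q where "q = (\<lambda>n x. (f (x + h n *\<^sub>R e) - f x) / h n)"
  have h: "0 < h n" "h n \<le> 1" for n by (auto simp: h_def divide_simps)
  have contf: "continuous_on B f" for B by (rule smooth_continuous_on[OF f])
  have contf': "continuous_on B f'" for B
    unfolding f'_def by (rule continuous_on_frechet_derivative_smooth[OF f])
  have contq: "continuous_on UNIV (q n)" for n
    unfolding q_def using h(1)[of n]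
    by (intro continuous_intros continuous_on_compose2[OF contf[of UNIV]]) auto
  have deriv: "((\<lambda>t. f (x + t *\<^sub>R e)) has_real_derivative f' (x + t *\<^sub>R e)) (at t)" for x t
    unfolding f'_def by (rule smooth_has_real_derivative_line[OF f])
  have qlim: "(\<lambda>n. q n x) \<longlonglongrightarrow> f' x" for x
  proof -
    have "((\<lambda>t. (f (x + t *\<^sub>R e) - f x) / t) \<longlongrightarrow> f' x) (at 0)"
      using deriv[of x 0] by (simp add: has_field_derivative_iff)
    moreover have "filterlim h (at 0) sequentially"
      using LIMSEQ_inverse_real_of_nat h(1) by (auto simp: filterlim_at h_def)
    ultimately show ?thesis unfolding q_def by (rule filterlim_compose)
  qed
  \<comment> \<open>By the mean value theorem each quotient is a value of \<open>f'\<close> on the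
    compact set swept by \<open>closure A\<close> under translations by t e with 0 \<le> t \<le> 1;
    \<open>h n \<le> 1\<close> makes this set independent of \<open>n\<close>.\<close>
  obtain B where B: "\<And>x n. x \<in> A \<Longrightarrow> \<bar>q n x\<bar> \<le> B"
  proof -
    let ?K = "(\<lambda>(x, t). x + t *\<^sub>R e) ` (closure A \<times> {0..1})"
    have "compact ?K"
    proof (rule compact_continuous_image)
      show "continuous_on (closure A \<times> {0..1}) (\<lambda>(x, t). x + t *\<^sub>R e)"
        unfolding case_prod_unfold by (intro continuous_intros)
      show "compact (closure A \<times> {0..1::real})" using A(2) by (intro compact_Times) auto
    qed
    then have "bounded (f' ` ?K)"
      using contf' by (intro compact_imp_bounded compact_continuous_image[of ?K f'])
    then obtain B where B: "\<And>y. y \<in> ?K \<Longrightarrow> \<bar>f' y\<bar> \<le> B"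
      unfolding bounded_iff real_norm_def by blast
    have "\<bar>q n x\<bar> \<le> B" if "x \<in> A" for x n
    proof -
      obtain z where z: "0 < z" "z < h n"
          "f (x + h n *\<^sub>R e) - f (x + 0 *\<^sub>R e) = (h n - 0) * f' (x + z *\<^sub>R e)"
        using MVT2[OF h(1)[of n] deriv] by blast
      then have "q n x = f' (x + z *\<^sub>R e)" using h(1)[of n] by (simp add: q_def)
      moreover have "x + z *\<^sub>R e \<in> ?K"
      proof (rule rev_image_eqI)
        show "(x, z) \<in> closure A \<times> {0..1}" using z h(2)[of n] that closure_subset by auto
      qed simp
      ultimately show ?thesis using B by simp
    qed
    then show ?thesis using that by blast
  qed
  have lim: "(\<lambda>n. LINT x:A|lborel. q n x) \<longlonglongrightarrow> (LINT x:A|lborel. f' x)"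
    unfolding set_lebesgue_integral_def
  proof (rule integral_dominated_convergence[where w = "\<lambda>x. indicator A x *\<^sub>R B"])
    note int = set_integrable_bounded_continuous[OF A, unfolded set_integrable_def]
    show "integrable lborel (\<lambda>x. indicator A x *\<^sub>R B)" by (intro int continuous_intros)
    show "(\<lambda>x. indicator A x *\<^sub>R f' x) \<in> borel_measurable lborel"
      using int[OF contf'] by blast
    show "(\<lambda>x. indicator A x *\<^sub>R q n x) \<in> borel_measurable lborel" for n
      using int[OF contq] by blast
    show "AE x in lborel. (\<lambda>n. indicator A x *\<^sub>R q n x) \<longlonglongrightarrow> indicator A x *\<^sub>R f' x"
      by (intro AE_I2 tendsto_scaleR qlim tendsto_const)
    show "AE x in lborel. norm (indicator A x *\<^sub>R q n x) \<le> indicator A x *\<^sub>R B" for n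
      using B by (auto simp: indicator_def)
  qed
  have "\<bar>LINT x:A|lborel. q n x\<bar> \<le> p" for n
  proof -
    let ?v = "h n *\<^sub>R e"
    let ?A = "{y. y - ?v \<in> A}"
    \<comment> \<open>The symmetric difference of \<open>A\<close> and its translate. Outside it the
      two indicator functions agree; on it they differ by 1 and \<open>f\<close> is at most 1 in
      absolute value.\<close>
    let ?D = "{y. (y - ?v \<in> A) \<noteq> (y \<in> A)}"
    have [measurable]: "A \<in> sets borel" by fact
    have "?A \<in> sets borel" by measurable
    have "?A \<subseteq> (+) ?v ` A"
    proof
      fix y assume "y \<in> ?A"
      then show "y \<in> (+) ?v ` A" by (intro image_eqI[of _ _ "y - ?v"]) simp_all
    qed
    then have bdd: "bounded ?A" by (rule bounded_subset[OF bounded_translation[OF A(2)]])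
    have D: "?D \<in> sets borel" by measurable
    have "?D \<subseteq> ?A \<union> A" by blast
    with A(2) bdd have "bounded ?D" by (meson bounded_Un bounded_subset)
    then have intD: "integrable lborel (indicat_real ?D)"
      using D by (intro integrable_real_indicator emeasure_bounded_finite) simp_all
    have iA': "set_integrable lborel ?A f"
      by (rule set_integrable_bounded_continuous[OF \<open>?A \<in> sets borel\<close> bdd contf])
    have iA: "set_integrable lborel A f"
      by (rule set_integrable_bounded_continuous[OF A contf])
    have "(LINT x:A|lborel. q n x) = (LINT x:A|lborel. f (x + ?v) - f x) / h n"
      unfolding q_def by (rule set_integral_divide_zero)
    also have "(LINT x:A|lborel. f (x + ?v) - f x) = (LINT x:A|lborel. f (x + ?v)) - (LINT x:A|lborel. f x)"
    proof (rule set_integral_diff(2)[OF _ iA])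
      have "continuous_on UNIV (\<lambda>x. f (x + ?v))"
        by (rule continuous_on_compose2[OF contf[of UNIV]]) (auto intro!: continuous_intros)
      then show "set_integrable lborel A (\<lambda>x. f (x + ?v))"
        by (rule set_integrable_bounded_continuous[OF A])
    qed
    also have "(LINT x:A|lborel. f (x + ?v)) = (LINT x:?A|lborel. f x)"
      using A(1) contf by (rule set_integral_translation)
    finally have q: "(LINT x:A|lborel. q n x) = ((LINT x:?A|lborel. f x) - (LINT x:A|lborel. f x)) / h n" .
    have "\<bar>(LINT x:?A|lborel. f x) - (LINT x:A|lborel. f x)\<bar>
        = norm (LINT x|lborel. indicator ?A x *\<^sub>R f x - indicator A x *\<^sub>R f x)"
      unfolding set_lebesgue_integral_def real_norm_def
      using iA iA' unfolding set_integrable_def by (subst Bochner_Integration.integral_diff) simp_all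
    also have "\<dots> \<le> (LINT x|lborel. indicator ?D x)"
    proof (rule Bochner_Integration.integral_norm_bound_integral)
      show "norm (indicator ?A x *\<^sub>R f x - indicator A x *\<^sub>R f x) \<le> indicat_real ?D x" for x
        using le1 by (auto simp: indicator_def)
      show "integrable lborel (\<lambda>x. indicator ?A x *\<^sub>R f x - indicator A x *\<^sub>R f x)"
        using iA iA' unfolding set_integrable_def by (intro Bochner_Integration.integrable_diff)
    qed (rule intD)
    also have "\<dots> = measure lborel ?D"
      by (subst Bochner_Integration.integral_indicator) simp_all
    also have "\<dots> \<le> h n * p" by (rule shift[OF e h(1)])
    finally show ?thesis
      unfolding q using h(1)[of n] by (simp add: abs_divide pos_divide_le_eq mult.commute)
  qed
  then have "\<bar>LINT x:A|lborel. f' x\<bar> \<le> p"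
    by (intro LIMSEQ_le_const2[OF tendsto_rabs[OF lim]]) auto
  then show "\<bar>LINT x:A|lborel. frechet_derivative f (at x) e\<bar> \<le> p"
    by (simp add: f'_def)
qed

text \<open>The integral is additive over the disjoint pieces. Faces common to two pieces are
  counted twice instead of cancelling, a loss that only affects constants.\<close>

lemma perimeter_le_UN:
  fixes A :: "'i \<Rightarrow> 'a::euclidean_space set"
  assumes "finite J" "disjoint_family_on A J"
    and "\<And>j. j \<in> J \<Longrightarrow> A j \<in> sets borel" "\<And>j. j \<in> J \<Longrightarrow> bounded (A j)"
    and "\<And>j. j \<in> J \<Longrightarrow> perimeter_le (A j) p"
  shows "perimeter_le (\<Union>j\<in>J. A j) (real (card J) * p)"
  unfolding perimeter_le_def
proof (intro allI impI)
  fix f :: "'a \<Rightarrow> real" and e :: 'a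
  assume f: "smooth f" "\<forall>x. \<bar>f x\<bar> \<le> 1" "e \<in> Basis"
  let ?g = "\<lambda>x. frechet_derivative f (at x) e"
  have "(LINT x:(\<Union>j\<in>J. A j)|lborel. ?g x) = (\<Sum>j\<in>J. LINT x:A j|lborel. ?g x)"
    using assms f(1) by (intro set_integral_finite_UN_AE AE_I2)
      (auto simp: disjoint_family_on_def
        intro!: set_integrable_bounded_continuous continuous_on_frechet_derivative_smooth)
  then have "\<bar>LINT x:(\<Union>j\<in>J. A j)|lborel. ?g x\<bar> \<le> (\<Sum>j\<in>J. \<bar>LINT x:A j|lborel. ?g x\<bar>)"
    by simp
  also have "\<dots> \<le> real (card J) * p"
    using assms(5) f unfolding perimeter_le_def by (intro sum_bounded_above) blast
  finally show "\<bar>LINT x:(\<Union>j\<in>J. A j)|lborel. ?g x\<bar> \<le> real (card J) * p" .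
qed

text \<open>On the coordinate frame, the exterior derivative is an alternating sum of d directional
  derivatives, each of the component on the frame with that direction removed. These components are
  bounded by 1, hence admissible in \<open>perimeter_le\<close>; estimating the terms one by one
  gives the factor d.\<close>

lemma mass_boundary_solid_current_le:
  fixes A :: "(real ^ 'n::{finite,linorder}) set"
  assumes "A \<in> sets borel" "bounded A" "perimeter_le A p"
  shows "mass (CARD('n) - 1) (boundary (solid_current A)) \<le> real CARD('n) * p"
  unfolding mass_def
proof (rule SUP_least)
  fix \<omega> :: "(real, 'n) vec form"
  assume "\<omega> \<in> {\<omega> \<in> smooth_forms (CARD('n) - 1). comass_sup (CARD('n) - 1) \<omega> \<le> 1}"
  then have w: "\<omega> \<in> smooth_forms (CARD('n) - 1)" "comass_sup (CARD('n) - 1) \<omega> \<le> 1" by auto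
  define vs where "vs = (\<lambda>i. take i std_basis @ drop (Suc i) (std_basis :: (real, 'n) vec list))"
  define g where "g = (\<lambda>i x. frechet_derivative (\<lambda>y. \<omega> y (vs i)) (at x) (std_basis ! i))"
  have int: "set_integrable lborel A (g i)" for i
    unfolding g_def using assms(1,2) w(1)
    by (intro set_integrable_bounded_continuous continuous_on_frechet_derivative_smooth smooth_formsD)
  have g: "\<bar>LINT x:A|lborel. g i x\<bar> \<le> p" if i: "i < CARD('n)" for i
  proof -
    have "length (vs i) = CARD('n) - 1" using i by (simp add: vs_def)
    moreover have "distinct (vs i)"
      by (auto simp: vs_def distinct_append set_take_disj_set_drop_if_distinct)
    moreover have "set (vs i) \<subseteq> Basis"
      using set_std_basis_subset by (auto simp: vs_def dest!: in_set_takeD in_set_dropD)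
    ultimately have "\<bar>\<omega> x (vs i)\<bar> \<le> 1" for x using w(2) by (intro abs_form_le_one)
    moreover have "(std_basis ! i :: (real, 'n) vec) \<in> Basis"
      using set_std_basis_subset i by (metis length_std_basis nth_mem subsetD)
    ultimately show ?thesis
      using assms(3) smooth_formsD[OF w(1)] unfolding perimeter_le_def g_def by blast
  qed
  have "boundary (solid_current A) \<omega> = (LINT x:A|lborel. \<Sum>i<CARD('n). (- 1) ^ i * g i x)"
    by (simp add: boundary_def solid_current_def ext_deriv_def g_def vs_def)
  also have "\<dots> = (\<Sum>i<CARD('n). LINT x:A|lborel. (- 1) ^ i * g i x)"
    unfolding set_lebesgue_integral_def scaleR_sum_right
    using set_integrable_mult_right[OF int] by (intro Bochner_Integration.integral_sum)
      (simp add: set_integrable_def)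
  also have "\<dots> = (\<Sum>i<CARD('n). (- 1) ^ i * (LINT x:A|lborel. g i x))"
    by (intro sum.cong set_integral_mult_right refl)
  also have "\<dots> \<le> (\<Sum>i<CARD('n). p)"
  proof (rule sum_mono)
    fix i assume "i \<in> {..<CARD('n)}"
    then have "\<bar>(- 1) ^ i * (LINT x:A|lborel. g i x)\<bar> \<le> p" using g by (simp add: abs_mult)
    then show "(- 1) ^ i * (LINT x:A|lborel. g i x) \<le> p" by linarith
  qed
  finally show "ereal (boundary (solid_current A) \<omega>) \<le> real CARD('n) * p" by simp
qed

section \<open>Dyadic cells\<close>

text \<open>
  The half-open cells \<open>cell k l\<close> partition the space, which avoids the overlaps of the closed cubes.
\<close>

definition dyadic_index :: "nat \<Rightarrow> real ^ 'n \<Rightarrow> 'n \<Rightarrow> int" where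
  "dyadic_index k x = (\<lambda>i. \<lfloor>2 ^ k * x $ i\<rfloor>)"

definition cell :: "nat \<Rightarrow> ('n \<Rightarrow> int) \<Rightarrow> (real ^ 'n) set" where
  "cell k l = {x. dyadic_index k x = l}"

text \<open>The closed counterpart of \<open>cell\<close>, written as in
  \<open>dyadic_cubes\<close>. Cells make up the layers, while closed cubes are tested for inclusion
  in U and counted in the hypothesis.\<close>

definition cube :: "nat \<Rightarrow> ('n \<Rightarrow> int) \<Rightarrow> (real ^ 'n::finite) set" where
  "cube k l = cbox (\<chi> i. of_int (l i) * 2 powi (- int k)) (\<chi> i. (of_int (l i) + 1) * 2 powi (- int k))"

lemma mem_cell: "x \<in> cell k l \<longleftrightarrow> (\<forall>i. of_int (l i) / 2 ^ k \<le> x $ i \<and> x $ i < (of_int (l i) + 1) / 2 ^ k)"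
  by (auto simp: cell_def dyadic_index_def fun_eq_iff floor_eq_iff field_simps)

lemma mem_cube: "x \<in> cube k l \<longleftrightarrow> (\<forall>i. of_int (l i) / 2 ^ k \<le> x $ i \<and> x $ i \<le> (of_int (l i) + 1) / 2 ^ k)"
  by (simp add: cube_def mem_box_cart power_int_minus divide_inverse)

lemma cell_subset_cube: "cell k l \<subseteq> cube k l"
  unfolding subset_iff mem_cell mem_cube using less_imp_le by blast

lemma mem_cell_dyadic_index: "x \<in> cell k (dyadic_index k x)"
  by (simp add: cell_def)

lemma bounded_cell: "bounded (cell k l)"
  using bounded_subset[OF bounded_cbox cell_subset_cube[unfolded cube_def]] .

lemma borel_cell [measurable]: "cell k l \<in> sets borel"
proof -
  have "cell k l = (\<Inter>i. {x. x $ i \<ge> of_int (l i) / 2 ^ k} \<inter> {x. x $ i < (of_int (l i) + 1) / 2 ^ k})"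
    by (auto simp: mem_cell)
  also have "\<dots> \<in> sets borel"
    by (intro sets.finite_INT sets.Int borel_closed borel_open closed_halfspace_component_ge_cart
        open_halfspace_component_lt_cart) auto
  finally show ?thesis .
qed

lemma disjoint_family_cell: "disjoint_family_on (cell k) J"
  by (auto simp: disjoint_family_on_def cell_def)

lemma measure_cell_le:
  fixes l :: "'n::finite \<Rightarrow> int"
  shows "measure lborel (cell k l) \<le> (1 / 2 ^ k) ^ CARD('n)"
proof -
  have ne: "cube k l \<noteq> {}"
  proof -
    have "(\<chi> i. of_int (l i) / 2 ^ k) \<in> cube k l" by (simp add: mem_cube divide_right_mono)
    then show ?thesis by blast
  qed
  have "measure lborel (cell k l) \<le> measure lborel (cube k l)"
    using cell_subset_cube by (intro measure_mono_fmeasurable) (auto simp: cube_def)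
  also have "\<dots> = (1 / 2 ^ k) ^ CARD('n)"
    using ne unfolding cube_def
    by (simp add: content_cbox_cart left_diff_distrib[symmetric] power_int_minus divide_inverse)
  finally show ?thesis .
qed

text \<open>Translating a cube along an axis by \<open>h\<close> changes membership only in two
  slabs of thickness \<open>h\<close>, one at each face orthogonal to the axis; hence the factor 2.
  The inclusion holds for every positive \<open>h\<close>, even beyond the side length.\<close>

lemma perimeter_le_cell:
  fixes l :: "'n::finite \<Rightarrow> int"
  shows "perimeter_le (cell k l) (2 * (1 / 2 ^ k) ^ (CARD('n) - 1))"
proof (rule perimeter_leI_translation)
  fix e :: "real ^ 'n" and h :: real
  assume "e \<in> Basis" and h: "0 < h"
  then obtain j where e: "e = axis j 1" by (auto simp: Basis_vec_def)
  define s :: real where "s = 1 / 2 ^ k"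
  define a :: "real ^ 'n" where "a = (\<chi> i. of_int (l i) / 2 ^ k)"
  have s: "s > 0" by (simp add: s_def)
  have cell: "x \<in> cell k l \<longleftrightarrow> (\<forall>i. a $ i \<le> x $ i \<and> x $ i < a $ i + s)" for x
    by (simp add: mem_cell a_def s_def add_divide_distrib)
  define slab where "slab = (\<lambda>t. cbox (\<chi> i. if i = j then a $ i + t else a $ i)
      (\<chi> i. if i = j then a $ i + t + h else a $ i + s))"
  have meas: "measure lborel (slab t) = h * s ^ (CARD('n) - 1)" for t
  proof -
    have "(\<chi> i. if i = j then a $ i + t else a $ i) \<in> slab t"
      using h s by (simp add: slab_def mem_box_cart)
    then have "slab t \<noteq> {}" by blast
    then have "measure lborel (slab t) = (\<Prod>i\<in>UNIV. if i = j then h else s)"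
      unfolding slab_def by (subst content_cbox_cart) (auto intro!: prod.cong split: if_splits)
    also have "\<dots> = h * (\<Prod>i\<in>UNIV - {j}. s)"
      by (subst prod.remove[of _ j]) auto
    also have "\<dots> = h * s ^ (CARD('n) - 1)" by (simp add: card_Diff_singleton)
    finally show ?thesis .
  qed
  have "{y. (y - h *\<^sub>R e \<in> cell k l) \<noteq> (y \<in> cell k l)} \<subseteq> slab 0 \<union> slab s"
  proof
    fix y assume "y \<in> {y. (y - h *\<^sub>R e \<in> cell k l) \<noteq> (y \<in> cell k l)}"
    then consider (low) "y \<in> cell k l" "y - h *\<^sub>R e \<notin> cell k l"
      | (high) "y \<notin> cell k l" "y - h *\<^sub>R e \<in> cell k l" by auto
    moreover have nth: "e $ i = (if i = j then 1 else 0)" for i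
      by (simp add: e axis_def)
    ultimately show "y \<in> slab 0 \<union> slab s"
    proof cases
      case low
      then have y: "a $ i \<le> y $ i" "y $ i < a $ i + s" for i by (auto simp: cell)
      obtain i where i: "\<not> (a $ i \<le> (y - h *\<^sub>R e) $ i \<and> (y - h *\<^sub>R e) $ i < a $ i + s)"
        using low(2) unfolding cell by blast
      then have "i = j" using y[of i] by (auto simp: nth split: if_splits)
      with i have "y $ j \<le> a $ j + h" using y[of j] h by (auto simp: nth)
      then have "y \<in> slab 0" using y less_imp_le[OF y(2)] by (auto simp: slab_def mem_box_cart)
      then show ?thesis by blast
    next
      case high
      then have y: "a $ i \<le> (y - h *\<^sub>R e) $ i" "(y - h *\<^sub>R e) $ i < a $ i + s" for i
        by (auto simp: cell)
      have y': "a $ i \<le> y $ i" "i \<noteq> j \<Longrightarrow> y $ i < a $ i + s" for i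
        using y[of i] h by (auto simp: nth split: if_splits)
      have "a $ j + s \<le> y $ j" using high(1) y' unfolding cell by (metis not_less)
      moreover have "y $ j \<le> a $ j + s + h" using y(2)[of j] by (simp add: nth)
      ultimately have "y \<in> slab s"
        using y'(1) less_imp_le[OF y'(2)] by (auto simp: slab_def mem_box_cart)
      then show ?thesis by blast
    qed
  qed
  then have "measure lborel {y. (y - h *\<^sub>R e \<in> cell k l) \<noteq> (y \<in> cell k l)}
      \<le> measure lborel (slab 0 \<union> slab s)"
  proof (rule measure_mono_fmeasurable)
    show "{y. (y - h *\<^sub>R e \<in> cell k l) \<noteq> (y \<in> cell k l)} \<in> sets lborel" by measurable
    show "slab 0 \<union> slab s \<in> fmeasurable lborel"
      unfolding slab_def by (intro fmeasurable.Un) auto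
  qed
  also have "\<dots> \<le> measure lborel (slab 0) + measure lborel (slab s)"
    by (intro measure_Un_le) (auto simp: slab_def)
  finally show "measure lborel {y. (y - h *\<^sub>R e \<in> cell k l) \<noteq> (y \<in> cell k l)}
      \<le> h * (2 * (1 / 2 ^ k) ^ (CARD('n) - 1))"
    unfolding meas by (simp add: s_def)
qed (use bounded_cell in auto)

text \<open>Since the floor of 2y is twice the floor of y, or one more, halving an index yields that
  of the parent. This relation underlies both the nesting of levels and the count of
  children.\<close>

lemma dyadic_index_Suc: "dyadic_index k x i = dyadic_index (Suc k) x i div 2"
proof -
  define y where "y = 2 ^ k * x $ i"
  have "2 * \<lfloor>y\<rfloor> \<le> \<lfloor>2 * y\<rfloor>" "\<lfloor>2 * y\<rfloor> < 2 * \<lfloor>y\<rfloor> + 2"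
    unfolding le_floor_iff floor_less_iff of_int_add of_int_mult of_int_numeral by linarith+
  then have "\<lfloor>y\<rfloor> = \<lfloor>2 * y\<rfloor> div 2" by presburger
  then show ?thesis by (simp add: dyadic_index_def y_def mult.assoc)
qed

lemma dyadic_index_eq_mono:
  assumes "dyadic_index k x = dyadic_index k y" "m \<le> k"
  shows "dyadic_index m x = dyadic_index m y"
  using assms(2,1)
proof (induction rule: inc_induct)
  case (step n)
  then have "dyadic_index (Suc n) x = dyadic_index (Suc n) y" by simp
  then show ?case by (simp add: fun_eq_iff dyadic_index_Suc[of n])
qed

lemma cube_Suc_subset: "cube (Suc k) m \<subseteq> cube k (\<lambda>i. m i div 2)"
proof
  fix x assume x: "x \<in> cube (Suc k) m"
  have "of_int (m i div 2) / 2 ^ k \<le> x $ i \<and> x $ i \<le> (of_int (m i div 2) + 1) / 2 ^ k" for i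
  proof -
    have "of_int (m i) \<le> 2 * (2 ^ k * x $ i)" "2 * (2 ^ k * x $ i) \<le> of_int (m i) + 1"
      using x by (auto simp: mem_cube field_simps)
    moreover have "2 * (m i div 2) \<le> m i" "m i + 1 \<le> 2 * (m i div 2) + 2" by presburger+
    then have "real_of_int (2 * (m i div 2)) \<le> real_of_int (m i)"
      "real_of_int (m i + 1) \<le> real_of_int (2 * (m i div 2) + 2)" by (simp_all only: of_int_le_iff)
    then have "2 * real_of_int (m i div 2) \<le> of_int (m i)"
      "real_of_int (m i) + 1 \<le> 2 * of_int (m i div 2) + 2" by simp_all
    ultimately have "of_int (m i div 2) \<le> 2 ^ k * x $ i" "2 ^ k * x $ i \<le> of_int (m i div 2) + 1"
      by linarith+
    then show ?thesis by (simp add: field_simps)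
  qed
  then show "x \<in> cube k (\<lambda>i. m i div 2)" by (simp add: mem_cube)
qed

text \<open>\<open>dyadic_count\<close> counts cubes as sets, whereas cells are counted by their
  indices; injectivity reconciles the two. Comparing lower corners gives one inequality per
  inclusion.\<close>

lemma inj_cube: "inj (cube k)"
proof (rule injI)
  fix l m :: "'a \<Rightarrow> int" assume eq: "cube k l = cube k m"
  have sub: "m i \<le> l i" if "cube k l \<subseteq> cube k m" for i and l m :: "'a \<Rightarrow> int"
  proof -
    have "(\<chi> i. of_int (l i) / 2 ^ k) \<in> cube k l" by (simp add: mem_cube divide_right_mono)
    with that have "(\<chi> i. of_int (l i) / 2 ^ k) \<in> cube k m" by blast
    then have "real_of_int (m i) / 2 ^ k \<le> of_int (l i) / 2 ^ k" unfolding mem_cube by simp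
    then show ?thesis by (simp add: divide_le_cancel)
  qed
  show "l = m" using sub[of l m] sub[of m l] eq by (auto simp: fun_eq_iff intro: antisym)
qed

lemma dyadic_count_eq: "dyadic_count A (int k) = card {l. cube k l \<inter> A \<noteq> {}}"
proof -
  have "{Q \<in> dyadic_cubes (int k). Q \<inter> A \<noteq> {}} = cube k ` {l. cube k l \<inter> A \<noteq> {}}"
    by (auto simp: dyadic_cubes_def cube_def)
  then show ?thesis
    unfolding dyadic_count_def by (simp add: card_image[OF inj_on_subset[OF inj_cube]])
qed

lemma finite_cubes_meeting:
  fixes A :: "(real ^ 'n::finite) set"
  assumes "bounded A"
  shows "finite {l. cube k l \<inter> A \<noteq> {}}"
proof -
  obtain B where B: "\<And>x. x \<in> A \<Longrightarrow> norm x \<le> B" using assms unfolding bounded_iff by blast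
  define M where "M = \<lceil>2 ^ k * B\<rceil>"
  \<comment> \<open>The extra -1 arises because a cube at the lower end may touch \<open>A\<close>
    with its upper face, which has coordinate \<open>l i + 1\<close>.\<close>
  have "l i \<in> {- M - 1..M}" if "cube k l \<inter> A \<noteq> {}" for l :: "'n \<Rightarrow> int" and i
  proof -
    obtain x where x: "x \<in> cube k l" "x \<in> A" using \<open>cube k l \<inter> A \<noteq> {}\<close> by blast
    have "\<bar>x $ i\<bar> \<le> B" using component_le_norm_cart[of x i] B[OF x(2)] by linarith
    then have "2 ^ k * \<bar>x $ i\<bar> \<le> 2 ^ k * B" by simp
    also have "\<dots> \<le> of_int M" by (simp add: M_def)
    finally have "\<bar>2 ^ k * x $ i\<bar> \<le> of_int M" by (simp add: abs_mult)
    moreover have "of_int (l i) \<le> 2 ^ k * x $ i" "2 ^ k * x $ i \<le> of_int (l i) + 1"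
      using x(1) by (auto simp: mem_cube field_simps)
    ultimately have "real_of_int (l i) \<le> of_int M" "real_of_int (- M) \<le> of_int (l i) + 1"
      unfolding of_int_minus by linarith+
    then show ?thesis by simp
  qed
  then have "{l. cube k l \<inter> A \<noteq> {}} \<subseteq> (UNIV :: 'n set) \<rightarrow>\<^sub>E {- M - 1..M}"
    by (intro subsetI PiE_I) simp_all
  then show ?thesis by (rule finite_subset) (intro finite_PiE, auto)
qed

section \<open>Unions of cells\<close>

text \<open>Invariance under equality of indices, rather than an explicit union of cells:
  differences and refinement then become purely logical.\<close>

definition dyadic_set :: "nat \<Rightarrow> (real ^ 'n) set \<Rightarrow> bool" where
  "dyadic_set k A \<longleftrightarrow> (\<forall>x y. dyadic_index k x = dyadic_index k y \<longrightarrow> x \<in> A \<longrightarrow> y \<in> A)"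

lemma dyadic_set_mono: "dyadic_set m A \<Longrightarrow> m \<le> k \<Longrightarrow> dyadic_set k A"
  unfolding dyadic_set_def using dyadic_index_eq_mono by blast

lemma dyadic_set_Diff: "dyadic_set k A \<Longrightarrow> dyadic_set k B \<Longrightarrow> dyadic_set k (A - B)"
  unfolding dyadic_set_def Diff_iff by metis

lemma dyadic_set_eq_UN:
  assumes "dyadic_set k A"
  shows "A = (\<Union>l\<in>dyadic_index k ` A. cell k l)"
proof
  show "A \<subseteq> (\<Union>l\<in>dyadic_index k ` A. cell k l)" using mem_cell_dyadic_index by blast
  show "(\<Union>l\<in>dyadic_index k ` A. cell k l) \<subseteq> A"
  proof
    fix y assume "y \<in> (\<Union>l\<in>dyadic_index k ` A. cell k l)"
    then obtain x where "x \<in> A" "dyadic_index k x = dyadic_index k y" by (auto simp: cell_def)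
    then show "y \<in> A" using assms unfolding dyadic_set_def by blast
  qed
qed

lemma finite_dyadic_index_image:
  fixes A :: "(real ^ 'n::finite) set"
  assumes "bounded A"
  shows "finite (dyadic_index k ` A)"
proof (rule finite_subset[OF _ finite_cubes_meeting[OF assms]])
  show "dyadic_index k ` A \<subseteq> {l. cube k l \<inter> A \<noteq> {}}"
    using mem_cell_dyadic_index cell_subset_cube by blast
qed

context
  fixes A :: "(real ^ 'n::{finite,linorder}) set" and k :: nat
  assumes A: "bounded A" "dyadic_set k A"
begin

lemma dyadic_set_borel: "A \<in> sets borel"
  by (subst dyadic_set_eq_UN[OF A(2)]) (intro sets.finite_UN finite_dyadic_index_image[OF A(1)] borel_cell)

lemma measure_dyadic_set_le:
  "measure lborel A \<le> real (card (dyadic_index k ` A)) * (1 / 2 ^ k) ^ CARD('n)"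
proof -
  have "measure lborel A \<le> (\<Sum>l\<in>dyadic_index k ` A. measure lborel (cell k l))"
    by (subst dyadic_set_eq_UN[OF A(2)]) (intro measure_UNION_le finite_dyadic_index_image[OF A(1)], simp)
  also have "\<dots> \<le> real (card (dyadic_index k ` A)) * (1 / 2 ^ k) ^ CARD('n)"
    by (intro sum_bounded_above measure_cell_le)
  finally show ?thesis .
qed

text \<open>Each cell contributes its volume to the mass and, for each of the d directions, a pair
  of opposite faces to the boundary mass.\<close>

lemma normal_mass_dyadic_set_le:
  "normal_mass CARD('n) (solid_current A) \<le> ereal (real (card (dyadic_index k ` A)) *
     ((1 / 2 ^ k) ^ CARD('n) + real CARD('n) * (2 * (1 / 2 ^ k) ^ (CARD('n) - 1))))"
proof -
  let ?c = "real (card (dyadic_index k ` A))" and ?p = "2 * (1 / 2 ^ k) ^ (CARD('n) - 1) :: real"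
  have "perimeter_le (\<Union>l\<in>dyadic_index k ` A. cell k l) (?c * ?p)"
    by (intro perimeter_le_UN finite_dyadic_index_image[OF A(1)] disjoint_family_cell borel_cell
        bounded_cell perimeter_le_cell)
  then have "perimeter_le A (?c * ?p)" by (subst dyadic_set_eq_UN[OF A(2)])
  then have "mass (CARD('n) - 1) (boundary (solid_current A)) \<le> ereal (real CARD('n) * (?c * ?p))"
    by (intro mass_boundary_solid_current_le dyadic_set_borel A)
  moreover have "mass CARD('n) (solid_current A) \<le> ereal (?c * (1 / 2 ^ k) ^ CARD('n))"
    using order_trans[OF mass_solid_current_le[OF dyadic_set_borel A(1)]] measure_dyadic_set_le by simp
  ultimately have "normal_mass CARD('n) (solid_current A)
      \<le> ereal (?c * (1 / 2 ^ k) ^ CARD('n)) + ereal (real CARD('n) * (?c * ?p))"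
    unfolding normal_mass_def by (simp only: zero_less_card_finite[THEN less_imp_neq, symmetric] if_False)
      (intro add_mono)
  also have "\<dots> = ereal (?c * ((1 / 2 ^ k) ^ CARD('n) + real CARD('n) * ?p))"
    by (simp add: algebra_simps)
  finally show ?thesis .
qed

lemma normal_current_dyadic_set: "normal_current CARD('n) (solid_current A)"
  unfolding normal_current_def
proof
  show "normal_mass CARD('n) (solid_current A) < \<infinity>"
    by (rule le_less_trans[OF normal_mass_dyadic_set_le]) simp
qed (rule current_solid_current[OF dyadic_set_borel A(1)])

end

section \<open>Interior dyadic approximations\<close>

text \<open>The level is shifted by one, so that the exhaustion of \<open>U\<close> starts from the empty set.\<close>

definition inner_approx :: "(real ^ 'n::finite) set \<Rightarrow> nat \<Rightarrow> (real ^ 'n) set" where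
  "inner_approx U k = {x. \<exists>j. k = Suc j \<and> cube j (dyadic_index j x) \<subseteq> U}"

lemma inner_approx_0 [simp]: "inner_approx U 0 = {}"
  by (simp add: inner_approx_def)

lemma mem_inner_approx_Suc:
  "x \<in> inner_approx U (Suc k) \<longleftrightarrow> cube k (dyadic_index k x) \<subseteq> U"
  by (simp add: inner_approx_def)

lemma mem_cube_dyadic_index: "x \<in> cube k (dyadic_index k x)"
  using mem_cell_dyadic_index cell_subset_cube by blast

lemma cube_dyadic_index_Suc_subset:
  "cube (Suc k) (dyadic_index (Suc k) x) \<subseteq> cube k (dyadic_index k x)"
proof -
  have "dyadic_index k x = (\<lambda>i. dyadic_index (Suc k) x i div 2)"
    by (rule ext) (rule dyadic_index_Suc)
  then show ?thesis by (simp only: cube_Suc_subset)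
qed

lemma inner_approx_subset: "inner_approx U k \<subseteq> U"
  unfolding inner_approx_def using mem_cube_dyadic_index by blast

lemma incseq_inner_approx: "incseq (inner_approx U)"
proof (rule incseq_SucI)
  fix k show "inner_approx U k \<subseteq> inner_approx U (Suc k)"
    using cube_dyadic_index_Suc_subset by (cases k) (auto simp: mem_inner_approx_Suc subset_iff)
qed

text \<open>Because of the shift, a positive stage \<open>j\<close> is defined by cubes of level
  \<open>j - 1\<close>, whence the bound \<open>Suc k\<close>.\<close>

lemma dyadic_set_inner_approx:
  assumes "j \<le> Suc k"
  shows "dyadic_set k (inner_approx U j)"
proof (cases j)
  case 0
  then show ?thesis by (simp add: dyadic_set_def)
next
  case (Suc i)
  have "dyadic_set i (inner_approx U (Suc i))" by (simp add: dyadic_set_def mem_inner_approx_Suc)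
  then show ?thesis unfolding Suc by (rule dyadic_set_mono) (use assms Suc in simp)
qed

lemma Union_inner_approx:
  fixes U :: "(real ^ 'n::finite) set"
  assumes "open U"
  shows "(\<Union>k. inner_approx U k) = U"
proof
  show "U \<subseteq> (\<Union>k. inner_approx U k)"
  proof
    fix x assume "x \<in> U"
    then obtain e where e: "e > 0" "ball x e \<subseteq> U" using assms open_contains_ball by blast
    have "(\<lambda>k. (1 / 2) ^ k :: real) \<longlonglongrightarrow> 0" by (rule LIMSEQ_power_zero) simp
    \<comment> \<open>The division by d anticipates bounding the Euclidean norm by the sum of the d
      coordinates.\<close>
    moreover have "0 < e / real CARD('n)" using e(1) by (intro divide_pos_pos) simp_all
    ultimately have "\<forall>\<^sub>F k in sequentially. (1 / 2) ^ k < e / real CARD('n)"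
      by (rule order_tendstoD(2))
    then obtain k where "(1 / 2) ^ k < e / real CARD('n)" by (auto simp: eventually_sequentially)
    then have k: "real CARD('n) * (1 / 2 ^ k) < e" by (simp add: field_simps power_divide)
    have "y \<in> ball x e" if y: "y \<in> cube k (dyadic_index k x)" for y
    proof -
      have "\<bar>(y - x) $ i\<bar> \<le> 1 / 2 ^ k" for i
      proof -
        have "of_int (dyadic_index k x i) / 2 ^ k \<le> y $ i"
          "y $ i \<le> of_int (dyadic_index k x i) / 2 ^ k + 1 / 2 ^ k"
          "of_int (dyadic_index k x i) / 2 ^ k \<le> x $ i"
          "x $ i \<le> of_int (dyadic_index k x i) / 2 ^ k + 1 / 2 ^ k"
          using y mem_cube_dyadic_index[of x k] by (auto simp: mem_cube add_divide_distrib)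
        then show ?thesis unfolding vector_minus_component by linarith
      qed
      then have "norm (y - x) \<le> real CARD('n) * (1 / 2 ^ k)"
        by (intro order_trans[OF norm_le_l1_cart] sum_bounded_above)
      with k show ?thesis by (simp add: dist_norm norm_minus_commute)
    qed
    with e(2) have "x \<in> inner_approx U (Suc k)" by (auto simp: mem_inner_approx_Suc)
    then show "x \<in> (\<Union>k. inner_approx U k)" by blast
  qed
qed (use inner_approx_subset in blast)

text \<open>
  A new cell of level \<open>k + 1\<close> is a child of a level \<open>k\<close> cube meeting \<open>U\<close> but not contained in it;
  by connectedness this parent meets \<open>\<partial>U\<close>, and every parent has \<open>2\<^sup>d\<close> children.
\<close>

lemma card_new_cells_le:
  fixes U :: "(real ^ 'n::finite) set"
  assumes "bounded (frontier U)"
  shows "card (dyadic_index (Suc k) ` (inner_approx U (Suc (Suc k)) - inner_approx U (Suc k)))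
    \<le> 2 ^ CARD('n) * dyadic_count (frontier U) (int k)"
proof -
  let ?B = "{l. cube k l \<inter> frontier U \<noteq> {}}"
  let ?E = "(UNIV :: 'n set) \<rightarrow>\<^sub>E {0, 1 :: int}"
  have fin: "finite ?B" using assms by (rule finite_cubes_meeting)
  have finE: "finite ?E" by (intro finite_PiE) auto
  \<comment> \<open>A child has index 2 l + b with l its parent and b a vector of parities, so pairs
    from \<open>?B\<close> and \<open>?E\<close> enumerate all candidates.\<close>
  have "dyadic_index (Suc k) ` (inner_approx U (Suc (Suc k)) - inner_approx U (Suc k))
      \<subseteq> (\<lambda>(l, b) i. 2 * l i + b i) ` (?B \<times> ?E)"
  proof (rule image_subsetI)
    fix x assume "x \<in> inner_approx U (Suc (Suc k)) - inner_approx U (Suc k)"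
    then have x: "cube (Suc k) (dyadic_index (Suc k) x) \<subseteq> U" "\<not> cube k (dyadic_index k x) \<subseteq> U"
      by (auto simp: mem_inner_approx_Suc)
    have "x \<in> cube k (dyadic_index k x) \<inter> U"
      using x(1) mem_cube_dyadic_index by blast
    moreover have "connected (cube k (dyadic_index k x))"
      unfolding cube_def by (intro convex_connected convex_box)
    ultimately have "cube k (dyadic_index k x) \<inter> frontier U \<noteq> {}"
      using x(2) by (intro connected_Int_frontier) auto
    moreover have "(\<lambda>i. dyadic_index (Suc k) x i mod 2) \<in> ?E"
    proof (rule PiE_I)
      show "dyadic_index (Suc k) x i mod 2 \<in> {0, 1}" for i by auto
    qed simp
    moreover have "dyadic_index (Suc k) x = (\<lambda>i. 2 * dyadic_index k x i + dyadic_index (Suc k) x i mod 2)"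
      by (simp add: fun_eq_iff dyadic_index_Suc[of k])
    ultimately show "dyadic_index (Suc k) x \<in> (\<lambda>(l, b) i. 2 * l i + b i) ` (?B \<times> ?E)"
      by (intro image_eqI[of _ _ "(dyadic_index k x, \<lambda>i. dyadic_index (Suc k) x i mod 2)"]) simp_all
  qed
  then have "card (dyadic_index (Suc k) ` (inner_approx U (Suc (Suc k)) - inner_approx U (Suc k)))
      \<le> card (?B \<times> ?E)"
    using fin finE by (meson card_image_le card_mono finite_SigmaI finite_imageI le_trans)
  also have "\<dots> = 2 ^ CARD('n) * dyadic_count (frontier U) (int k)"
    by (simp add: card_cartesian_product card_PiE dyadic_count_eq numeral_2_eq_2)
  finally show ?thesis .
qed

section \<open>Summation\<close>

text \<open>The exponents 1 - \<alpha> and \<alpha> add up to 1, which leaves N to the first power,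
  and m (1 - \<alpha>) + (m + 1) \<alpha> = m + \<alpha>. If N = 0, then M = F = 0 and both sides
  vanish, as \<open>0 powr x = 0\<close> for every \<open>x\<close>.\<close>

lemma powr_interpolation_le:
  fixes M F :: real
  assumes "0 \<le> \<alpha>" "\<alpha> \<le> 1" "0 \<le> M" "0 \<le> F" "0 \<le> N" "0 < C"
    and M: "M \<le> C * N * (1 / 2 ^ k) ^ m" and F: "F \<le> N * (1 / 2 ^ k) ^ Suc m"
  shows "M powr (1 - \<alpha>) * F powr \<alpha> \<le> C powr (1 - \<alpha>) * (N * 2 powr - (real k * (real m + \<alpha>)))"
proof (cases "N = 0")
  case True
  then show ?thesis using assms by simp
next
  case False
  with \<open>0 \<le> N\<close> have N: "N > 0" by simp
  have q: "(1 / 2 ^ k) ^ n = 2 powr - (real k * real n)" for n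
  proof -
    have "(1 / 2 ^ k) ^ n = inverse (2 ^ (k * n) :: real)"
      by (simp add: power_divide power_mult power_inverse divide_inverse)
    also have "\<dots> = 2 powr - real (k * n)" unfolding powr_minus by (subst powr_realpow) simp_all
    finally show ?thesis by simp
  qed
  have "M powr (1 - \<alpha>) * F powr \<alpha>
      \<le> (C * N * (1 / 2 ^ k) ^ m) powr (1 - \<alpha>) * (N * (1 / 2 ^ k) ^ Suc m) powr \<alpha>"
    using assms by (intro mult_mono powr_mono2) auto
  also have "\<dots> = C powr (1 - \<alpha>) * (N powr (1 - \<alpha>) * N powr \<alpha>) *
      ((2 powr - (real k * real m)) powr (1 - \<alpha>) * (2 powr - (real k * real (Suc m))) powr \<alpha>)"
    unfolding q using N \<open>0 < C\<close> by (simp add: powr_mult)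
  also have "N powr (1 - \<alpha>) * N powr \<alpha> = N"
    using N by (simp add: powr_add[symmetric])
  also have "(2 powr - (real k * real m)) powr (1 - \<alpha>) * (2 powr - (real k * real (Suc m))) powr \<alpha>
      = 2 powr - (real k * (real m + \<alpha>))"
    by (simp add: powr_powr powr_add[symmetric] algebra_simps)
  finally show ?thesis by (simp add: mult.assoc)
qed

text \<open>Nonnegativity excludes minus infinity, which \<open>real_of_ereal\<close> sends to
  0.\<close>

lemma real_of_ereal_le: "0 \<le> x \<Longrightarrow> x \<le> ereal r \<Longrightarrow> real_of_ereal x \<le> r"
  by (cases x) auto

lemma real_of_ereal_nonneg: "0 \<le> x \<Longrightarrow> 0 \<le> real_of_ereal x"
  by (cases x) auto

theorem proposition3p2:
  fixes U :: "(real ^ 'n::{finite,linorder}) set" and \<alpha> :: real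
  assumes "0 \<le> \<alpha>" and "\<alpha> \<le> 1"
    and "open U" and "bounded U"
    and "summable_set (real CARD('n) - 1 + \<alpha>) (frontier U)"
  shows "fractional \<alpha> CARD('n) (solid_current U)"
proof -
  let ?d = "CARD('n)"
  define V where "V = inner_approx U"
  \<comment> \<open>As \<open>V 0\<close> is empty, \<open>S 0\<close> integrates over the unit
    cells whose closed cubes lie in U, and the partial sums telescope to \<open>V n\<close> without
    an extra term.\<close>
  define S where "S = (\<lambda>k. solid_current (V (Suc k) - V k))"
  have VU: "V k \<subseteq> U" for k unfolding V_def by (rule inner_approx_subset)
  have V: "incseq V" "(\<Union>k. V k) = U" "V 0 = {}"
    unfolding V_def using incseq_inner_approx Union_inner_approx assms(3) by auto
  have bdd: "bounded (V j - V k)" for j k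
    using VU by (intro bounded_subset[OF assms(4)]) blast
  have V_bdd: "bounded (V j)" for j using VU by (rule bounded_subset[OF assms(4)])
  have dya: "dyadic_set j (V j - V k)" if "k \<le> j" for j k
    unfolding V_def using that by (intro dyadic_set_Diff dyadic_set_inner_approx) simp_all
  have borel: "V j - V k \<in> sets borel" if "k \<le> j" for j k
    using dyadic_set_borel[OF bdd dya[OF that]] .
  have V_borel: "V j \<in> sets borel" for j using borel[of 0 j] V(3) by simp
  have normal: "normal_current ?d (solid_current (V j - V k))" if "k \<le> j" for j k
    using normal_current_dyadic_set[OF bdd dya[OF that]] .
  have S_normal: "normal_current ?d (S k)" for k unfolding S_def by (rule normal) simp
  have flat: "flat_approx ?d (\<lambda>n. solid_current (V n)) (solid_current U)"
    using normal[of 0] V V_borel assms(4) by (intro flat_approx_solid_current) auto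
  have current_U: "current ?d (solid_current U)"
    using assms(3,4) by (intro current_solid_current) auto
  have partial_sum: "(\<Sum>k<n. S k \<omega>) = solid_current (V n) \<omega>" if "\<omega> \<in> smooth_forms ?d" for n \<omega>
  proof (induction n)
    case 0
    then show ?case by (simp add: V(3) solid_current_def set_lebesgue_integral_def)
  next
    case (Suc n)
    have "S n \<omega> = solid_current (V (Suc n)) \<omega> - solid_current (V n) \<omega>"
      unfolding S_def using V(1) V_borel V_bdd that
      by (intro solid_current_Diff[of _ _ _ ?d]) (auto dest: incseq_SucD)
    with Suc show ?case by simp
  qed
  have tail: "flat_norm ?d (\<lambda>\<omega>. solid_current U \<omega> - (\<Sum>k<n. S k \<omega>)) \<le> measure lborel (U - V n)"
    "0 \<le> flat_norm ?d (\<lambda>\<omega>. solid_current U \<omega> - (\<Sum>k<n. S k \<omega>))" for n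
  proof -
    let ?T = "\<lambda>\<omega>. solid_current U \<omega> - (\<Sum>k<n. S k \<omega>)"
    have UV: "(\<Union>j. V (n + j) - V n) = U - V n"
    proof -
      have "V j \<subseteq> V (n + j)" for j using V(1) by (simp add: incseq_def)
      then show ?thesis using V(2) by blast
    qed
    have T: "?T \<omega> = solid_current (U - V n) \<omega>" if "\<omega> \<in> smooth_forms ?d" for \<omega>
    proof -
      have "solid_current (U - V n) \<omega> = solid_current U \<omega> - solid_current (V n) \<omega>"
        using assms(3) V_borel VU that by (intro solid_current_Diff[OF _ _ assms(4)]) auto
      then show ?thesis by (simp add: partial_sum[OF that])
    qed
    \<comment> \<open>Evaluating \<open>flat_norm\<close> on the remainder requires an approximating
      sequence of its own: the later stages with \<open>V n\<close> removed exhaust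
      \<open>U - V n\<close>.\<close>
    have "flat_approx ?d (\<lambda>j. solid_current (V (n + j) - V n)) ?T"
    proof (rule flat_approx_solid_current)
      show "incseq (\<lambda>j. V (n + j) - V n)"
        using incseq_SucD[OF V(1)] by (intro incseq_SucI Diff_mono) simp_all
      show "bounded (\<Union>j. V (n + j) - V n)" unfolding UV using assms(4) by (rule bounded_subset) auto
      show "?T \<omega> = solid_current (\<Union>j. V (n + j) - V n) \<omega>" if "\<omega> \<in> smooth_forms ?d" for \<omega>
        unfolding UV by (rule T[OF that])
    qed (auto intro: borel normal)
    then have "flat_norm ?d ?T = normal_flat_norm ?d ?T" by (rule flat_norm_eq)
    also have "\<dots> = normal_flat_norm ?d (solid_current (U - V n))"
      by (rule normal_flat_norm_cong) (rule T)
    finally have eq: "flat_norm ?d ?T = normal_flat_norm ?d (solid_current (U - V n))" .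
    have UVn: "U - V n \<in> sets borel" "bounded (U - V n)"
      using assms(3) V_borel by (auto intro: bounded_subset[OF assms(4)])
    show "flat_norm ?d ?T \<le> measure lborel (U - V n)"
      unfolding eq by (rule order_trans[OF normal_flat_norm_le_mass mass_solid_current_le[OF UVn]])
    show "0 \<le> flat_norm ?d ?T"
      unfolding eq by (rule normal_flat_norm_nonneg) (rule current_zero[OF current_solid_current[OF UVn]])
  qed
  have "(\<lambda>n. measure lborel (U - V n)) \<longlonglongrightarrow> 0"
    using measure_Diff_incseq_tendsto_0[OF V(1) V_borel] assms(4) by (simp add: V(2))
  then have tail0: "(\<lambda>n. ereal (measure lborel (U - V n))) \<longlonglongrightarrow> 0"
    by (simp add: zero_ereal_def)
  have lim: "(\<lambda>n. flat_norm ?d (\<lambda>\<omega>. solid_current U \<omega> - (\<Sum>k<n. S k \<omega>))) \<longlonglongrightarrow> 0"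
    by (rule tendsto_sandwich[OF always_eventually always_eventually tendsto_const tail0])
      (simp_all add: tail)
  have sum: "summable (\<lambda>k. real_of_ereal (normal_mass ?d (S k)) powr (1 - \<alpha>) *
      real_of_ereal (normal_flat_norm ?d (S k)) powr \<alpha>)" (is "summable ?f")
  \<comment> \<open>The cells of \<open>S 0\<close> have no parents that could be charged to the
    boundary; a single term does not affect summability, so the estimate starts at
    \<open>Suc k\<close>.\<close>
  proof (subst summable_Suc_iff[symmetric], rule summable_comparison_test')
    let ?N = "\<lambda>k. real (dyadic_count (frontier U) (int k))"
    \<comment> \<open>The summand 1 accounts for the volume; in the other one, d counts directions,
      2 opposite faces and 2 ^ d the children of a parent.\<close>
    let ?C = "1 + real ?d * 2 * 2 ^ ?d"
    have d: "?d = Suc (?d - 1)" "real ?d - 1 = real (?d - 1)" using zero_less_card_finite[where 'a='n] by simp_all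
    show "summable (\<lambda>k. ?C powr (1 - \<alpha>) * (?N k * 2 powr - (real k * (real (?d - 1) + \<alpha>))))"
      using assms(5) unfolding summable_set_def d(2) by (intro summable_mult) simp
    fix k :: nat
    let ?A = "V (Suc (Suc k)) - V (Suc k)"
    let ?q = "1 / 2 ^ k :: real" and ?t = "1 / 2 ^ Suc k :: real"
    let ?c = "real (card (dyadic_index (Suc k) ` ?A))"
    \<comment> \<open>The new cells have level \<open>Suc k\<close>, one finer than the frontier
      cubes that bound their number.\<close>
    have A: "bounded ?A" "dyadic_set (Suc k) ?A"
      by (rule bdd) (simp add: V_def dyadic_set_Diff dyadic_set_inner_approx)
    have "card (dyadic_index (Suc k) ` ?A) \<le> 2 ^ ?d * dyadic_count (frontier U) (int k)"
      unfolding V_def using assms(5) by (intro card_new_cells_le) (simp add: summable_set_def)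
    then have c: "?c \<le> 2 ^ ?d * ?N k" by (metis of_nat_le_iff of_nat_mult of_nat_numeral of_nat_power)
    \<comment> \<open>The children fill their parent, so the volume bound has constant 1, as
      \<open>powr_interpolation_le\<close> expects of \<open>F\<close>.\<close>
    have t: "2 ^ ?d * ?t ^ ?d = ?q ^ ?d" by (simp add: power_mult_distrib[symmetric])
    have "?c * ?t ^ ?d \<le> (2 ^ ?d * ?N k) * ?t ^ ?d" by (intro mult_right_mono c) simp
    also have "\<dots> = ?N k * ?q ^ ?d" unfolding t[symmetric] by simp
    finally have vol: "?c * ?t ^ ?d \<le> ?N k * ?q ^ ?d" .
    \<comment> \<open>Side lengths are at most 1, so the volume is absorbed into the perimeter scale
      and the normal mass obeys a bound with the single exponent d - 1.\<close>
    have "?q ^ ?d \<le> ?q ^ (?d - 1)" by (intro power_decreasing) (simp_all add: divide_simps)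
    then have vol': "?c * ?t ^ ?d \<le> ?N k * ?q ^ (?d - 1)"
      by (intro order_trans[OF vol] mult_left_mono) simp_all
    have "?t ^ (?d - 1) \<le> ?q ^ (?d - 1)" by (intro power_mono) (simp_all add: divide_simps)
    with c have "?c * ?t ^ (?d - 1) \<le> (2 ^ ?d * ?N k) * ?q ^ (?d - 1)" by (intro mult_mono) simp_all
    then have bd: "real ?d * 2 * (?c * ?t ^ (?d - 1)) \<le> real ?d * 2 * ((2 ^ ?d * ?N k) * ?q ^ (?d - 1))"
      by (intro mult_left_mono) simp_all
    have "?c * (?t ^ ?d + real ?d * (2 * ?t ^ (?d - 1)))
        = ?c * ?t ^ ?d + real ?d * 2 * (?c * ?t ^ (?d - 1))"
      by (simp only: distrib_left mult_ac)
    also have "\<dots> \<le> ?N k * ?q ^ (?d - 1) + real ?d * 2 * ((2 ^ ?d * ?N k) * ?q ^ (?d - 1))"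
      by (rule add_mono[OF vol' bd])
    also have "\<dots> = ?C * ?N k * ?q ^ (?d - 1)"
      by (simp add: algebra_simps)
    finally have M: "?c * (?t ^ ?d + real ?d * (2 * ?t ^ (?d - 1))) \<le> ?C * ?N k * ?q ^ (?d - 1)" .
    have S: "current ?d (S (Suc k))" using S_normal unfolding normal_current_def by blast
    have F0: "0 \<le> normal_flat_norm ?d (S (Suc k))"
      by (rule normal_flat_norm_nonneg) (rule current_zero[OF S])
    have "normal_flat_norm ?d (S (Suc k)) \<le> measure lborel ?A"
      unfolding S_def using dyadic_set_borel[OF A] A(1)
      by (intro order_trans[OF normal_flat_norm_le_mass mass_solid_current_le])
    moreover have "measure lborel ?A \<le> ?N k * ?q ^ ?d"
      by (rule order_trans[OF measure_dyadic_set_le[OF A] vol])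
    ultimately have F1: "normal_flat_norm ?d (S (Suc k)) \<le> ereal (?N k * ?q ^ ?d)"
      by (meson ereal_less_eq(3) order_trans)
    have M0: "0 \<le> normal_mass ?d (S (Suc k))"
      unfolding normal_mass_def
      by (auto intro!: add_nonneg_nonneg mass_nonneg simp: boundary_def ext_deriv_zero current_zero[OF S])
    have M1: "normal_mass ?d (S (Suc k)) \<le> ereal (?C * ?N k * ?q ^ (?d - 1))"
      unfolding S_def using normal_mass_dyadic_set_le[OF A] M by (meson ereal_less_eq(3) order_trans)
    have "?f (Suc k) \<le> ?C powr (1 - \<alpha>) * (?N k * 2 powr - (real k * (real (?d - 1) + \<alpha>)))"
    proof (rule powr_interpolation_le)
      show "real_of_ereal (normal_flat_norm ?d (S (Suc k))) \<le> ?N k * ?q ^ Suc (?d - 1)"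
        using real_of_ereal_le[OF F0 F1] d(1) by simp
    qed (use assms(1,2) M0 F0 real_of_ereal_le[OF M0 M1] in \<open>auto intro: real_of_ereal_nonneg add_pos_nonneg\<close>)
    then show "norm (?f (Suc k)) \<le> ?C powr (1 - \<alpha>) * (?N k * 2 powr - (real k * (real (?d - 1) + \<alpha>)))"
      by simp
  qed
  have spt: "spt ?d (S k) \<subseteq> closure U" for k
  proof -
    have "closure (V (Suc k) - V k) \<subseteq> closure U" using VU by (intro closure_mono) blast
    then show ?thesis unfolding S_def using spt_solid_current by blast
  qed
  have "\<exists>K. compact K \<and> (\<forall>k. spt ?d (S k) \<subseteq> K)"
    using spt assms(4) by (intro exI[of _ "closure U"]) simp
  then show ?thesis
    unfolding fractional_def flat_current_def
    using flat current_U S_normal sum lim by (intro conjI exI[of _ S] exI[of _ "\<lambda>n. solid_current (V n)"]) simp_all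
qed

end
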